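(* Let $(\Omega,\Sigma,\mu)$ be a finite measure space and let $Y$ be a Banach space. Then $$\mathcal{W}(L_1(\mu),Y)=\overline{\mathcal{W}(L_1(\mu),Y)\cap\operatorname{RSE}(L_1(\mu),Y)}.$$
   Context: Banach spaces are over $\mathbb{K}$, where $\mathbb{K}=\mathbb{R}$ or $\mathbb{C}$, and are nonzero (in particular $L_1(\mu)\neq\{0\}$). $\mathbb{T}=\{\theta\in\mathbb{K}\colon |\theta|=1\}$; $B_X$, $S_X$ are the closed unit ball and unit sphere of $X$; $\mathcal{L}(X,Y)$ is the space of bounded linear operators with the operator norm, and closures are in this norm. $\mathcal{W}(X,Y)\subseteq\mathcal{L}(X,Y)$ is the set of weakly compact operators. $T\in\operatorname{RSE}(X,Y)$ (range strongly exposing) means: there exists $x_0\in S_X$ such that whenever $(x_n)\subseteq B_X$ satisfies $\|Tx_n\|\to\|T\|$, there are a subsequence $(x_{\sigma(n)})$ and $\theta\in\mathbb{T}$ with $Tx_{\sigma(n)}\to\theta Tx_0$ in norm. *)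

theory Defs
  imports "HOL-Analysis.Analysis"
begin

text \<open>
  The scalar field is a type \<open>'k\<close>, used at \<open>real\<close> and \<open>complex\<close>.  The target space is a type
  \<open>'y\<close> of class \<^class>\<open>banach\<close> with an explicit scalar multiplication by \<open>'k\<close>, since the library
  has no class of complex normed spaces.  For \<open>'k = real\<close> the last axiom forces
  \<open>smul = scaleR\<close>.
\<close>

locale banach_space_over = vector_space smul
  for smul :: "'k::real_normed_field \<Rightarrow> 'y::banach \<Rightarrow> 'y" +
  assumes norm_smul: "norm (smul c y) = norm c * norm y"
    and smul_of_real: "smul (of_real r) y = r *\<^sub>R y"

text \<open>
  The domain depends on the measure and so cannot be a type; it is given by a carrier set with
  its operations.
\<close>

record ('k, 'x) normed_space =
  points :: "'x set"
  vzero :: 'x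
  vadd :: "'x \<Rightarrow> 'x \<Rightarrow> 'x"
  vscale :: "'k \<Rightarrow> 'x \<Rightarrow> 'x"
  vnorm :: "'x \<Rightarrow> real"

definition unit_ball :: "('k, 'x) normed_space \<Rightarrow> 'x set" where
  "unit_ball X = {x \<in> points X. vnorm X x \<le> 1}"

definition unit_sphere :: "('k, 'x) normed_space \<Rightarrow> 'x set" where
  "unit_sphere X = {x \<in> points X. vnorm X x = 1}"

text \<open>
  Operators are \<^const>\<open>extensional\<close> (constantly \<^const>\<open>undefined\<close> off the carrier), so that equality of
  operators is equality of HOL functions.
\<close>

definition bounded_operators ::
  "('k, 'x) normed_space \<Rightarrow> ('k \<Rightarrow> 'y \<Rightarrow> 'y) \<Rightarrow> ('x \<Rightarrow> 'y::real_normed_vector) set" where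
  "bounded_operators X smul =
    {T \<in> extensional (points X).
       (\<forall>x\<in>points X. \<forall>x'\<in>points X. T (vadd X x x') = T x + T x') \<and>
       (\<forall>c. \<forall>x\<in>points X. T (vscale X c x) = smul c (T x)) \<and>
       (\<exists>C. \<forall>x\<in>points X. norm (T x) \<le> C * vnorm X x)}"

definition op_norm :: "('k, 'x) normed_space \<Rightarrow> ('x \<Rightarrow> 'y::real_normed_vector) \<Rightarrow> real" where
  "op_norm X T = (SUP x\<in>unit_ball X. norm (T x))"

definition op_closure ::
  "('k, 'x) normed_space \<Rightarrow> ('k \<Rightarrow> 'y \<Rightarrow> 'y) \<Rightarrow> ('x \<Rightarrow> 'y::real_normed_vector) set
     \<Rightarrow> ('x \<Rightarrow> 'y) set" where
  "op_closure X smul A =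
    {T \<in> bounded_operators X smul. \<forall>\<epsilon>>0. \<exists>S\<in>A. op_norm X (\<lambda>x. T x - S x) < \<epsilon>}"

definition dual :: "('k \<Rightarrow> 'y \<Rightarrow> 'y) \<Rightarrow> ('y::real_normed_vector \<Rightarrow> 'k::real_normed_field) set" where
  "dual smul = {\<phi>. bounded_linear \<phi> \<and> (\<forall>c y. \<phi> (smul c y) = c * \<phi> y)}"

definition weak_topology ::
  "('k::real_normed_field \<Rightarrow> 'y \<Rightarrow> 'y::real_normed_vector) \<Rightarrow> 'y topology" where
  "weak_topology smul = topology_generated_by {\<phi> -` U | \<phi> U. \<phi> \<in> dual smul \<and> open U}"

definition weakly_compact_operators ::
  "('k::real_normed_field, 'x) normed_space \<Rightarrow> ('k \<Rightarrow> 'y \<Rightarrow> 'y)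
     \<Rightarrow> ('x \<Rightarrow> 'y::real_normed_vector) set" where
  "weakly_compact_operators X smul =
    {T \<in> bounded_operators X smul.
       compactin (weak_topology smul) (weak_topology smul closure_of (T ` unit_ball X))}"

definition RSE ::
  "('k::real_normed_field, 'x) normed_space \<Rightarrow> ('k \<Rightarrow> 'y \<Rightarrow> 'y)
     \<Rightarrow> ('x \<Rightarrow> 'y::real_normed_vector) set" where
  "RSE X smul =
    {T \<in> bounded_operators X smul.
       \<exists>x\<^sub>0\<in>unit_sphere X. \<forall>x :: nat \<Rightarrow> 'x.
         (\<forall>n. x n \<in> unit_ball X) \<longrightarrow> (\<lambda>n. norm (T (x n))) \<longlonglongrightarrow> op_norm X T \<longrightarrow>
         (\<exists>\<sigma> :: nat \<Rightarrow> nat. \<exists>\<theta> :: 'k. strict_mono \<sigma> \<and> norm \<theta> = 1 \<and>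
            (\<lambda>n. T (x (\<sigma> n))) \<longlonglongrightarrow> smul \<theta> (T x\<^sub>0))}"

definition ae_eq_rel ::
  "'a measure \<Rightarrow> (('a \<Rightarrow> 'k::{banach, second_countable_topology}) \<times> ('a \<Rightarrow> 'k)) set" where
  "ae_eq_rel M = {(f, g). integrable M f \<and> integrable M g \<and> (AE \<omega> in M. f \<omega> = g \<omega>)}"

text \<open>
  Points of \<open>L1 M\<close> are the a.e.-equality classes of integrable functions.  The operations are lifted
  from representatives and do not depend on their choice (lemmas below).
\<close>

definition L1 ::
  "'a measure \<Rightarrow> ('k::{real_normed_field, banach, second_countable_topology}, ('a \<Rightarrow> 'k) set) normed_space"
  where
  "L1 M = \<lparr>
     points = {f. integrable M f} // ae_eq_rel M,
     vzero = ae_eq_rel M `` {\<lambda>\<omega>. 0},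
     vadd = (\<lambda>A B. \<Union>f\<in>A. \<Union>g\<in>B. ae_eq_rel M `` {\<lambda>\<omega>. f \<omega> + g \<omega>}),
     vscale = (\<lambda>c A. \<Union>f\<in>A. ae_eq_rel M `` {\<lambda>\<omega>. c * f \<omega>}),
     vnorm = (\<lambda>A. the_elem ((\<lambda>f. \<integral>\<omega>. norm (f \<omega>) \<partial>M) ` A)) \<rparr>"

lemma equiv_ae_eq_rel: "equiv {f. integrable M f} (ae_eq_rel M)"
  unfolding ae_eq_rel_def by (intro equivI refl_onI symI transI) auto

lemma vadd_L1:
  fixes f g :: "'a \<Rightarrow> 'k::{real_normed_field, banach, second_countable_topology}"
  assumes "integrable M f" "integrable M g"
  shows "vadd (L1 M) (ae_eq_rel M `` {f}) (ae_eq_rel M `` {g}) = ae_eq_rel M `` {\<lambda>\<omega>. f \<omega> + g \<omega>}"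
proof -
  have "congruent2 (ae_eq_rel M) (ae_eq_rel M) (\<lambda>f g :: 'a \<Rightarrow> 'k. ae_eq_rel M `` {\<lambda>\<omega>. f \<omega> + g \<omega>})"
  proof (rule congruent2I')
    fix f f' g g' :: "'a \<Rightarrow> 'k"
    assume "(f, f') \<in> ae_eq_rel M" "(g, g') \<in> ae_eq_rel M"
    then have "(\<lambda>\<omega>. f \<omega> + g \<omega>, \<lambda>\<omega>. f' \<omega> + g' \<omega>) \<in> ae_eq_rel M"
      by (auto simp: ae_eq_rel_def)
    then show "ae_eq_rel M `` {\<lambda>\<omega>. f \<omega> + g \<omega>} = ae_eq_rel M `` {\<lambda>\<omega>. f' \<omega> + g' \<omega>}"
      by (rule equiv_class_eq[OF equiv_ae_eq_rel])
  qed
  from UN_equiv_class2[OF equiv_ae_eq_rel equiv_ae_eq_rel this] assms show ?thesis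
    by (simp add: L1_def)
qed

lemma vscale_L1:
  fixes f :: "'a \<Rightarrow> 'k::{real_normed_field, banach, second_countable_topology}"
  assumes "integrable M f"
  shows "vscale (L1 M) c (ae_eq_rel M `` {f}) = ae_eq_rel M `` {\<lambda>\<omega>. c * f \<omega>}"
proof -
  have "congruent (ae_eq_rel M) (\<lambda>f :: 'a \<Rightarrow> 'k. ae_eq_rel M `` {\<lambda>\<omega>. c * f \<omega>})"
  proof (rule congruentI)
    fix f f' :: "'a \<Rightarrow> 'k"
    assume "(f, f') \<in> ae_eq_rel M"
    then have "(\<lambda>\<omega>. c * f \<omega>, \<lambda>\<omega>. c * f' \<omega>) \<in> ae_eq_rel M"
      by (auto simp: ae_eq_rel_def)
    then show "ae_eq_rel M `` {\<lambda>\<omega>. c * f \<omega>} = ae_eq_rel M `` {\<lambda>\<omega>. c * f' \<omega>}"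
      by (rule equiv_class_eq[OF equiv_ae_eq_rel])
  qed
  from UN_equiv_class[OF equiv_ae_eq_rel this] assms show ?thesis
    by (simp add: L1_def)
qed

lemma vnorm_L1:
  fixes f :: "'a \<Rightarrow> 'k::{real_normed_field, banach, second_countable_topology}"
  assumes "integrable M f"
  shows "vnorm (L1 M) (ae_eq_rel M `` {f}) = (\<integral>\<omega>. norm (f \<omega>) \<partial>M)"
proof -
  have *: "(\<integral>\<omega>. norm (g \<omega>) \<partial>M) = (\<integral>\<omega>. norm (f \<omega>) \<partial>M)" if "g \<in> ae_eq_rel M `` {f}" for g
  proof (rule integral_cong_AE)
    show "AE \<omega> in M. norm (g \<omega>) = norm (f \<omega>)"
      using that by (auto simp: ae_eq_rel_def)
    show "(\<lambda>\<omega>. norm (g \<omega>)) \<in> borel_measurable M" "(\<lambda>\<omega>. norm (f \<omega>)) \<in> borel_measurable M"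
      using that by (auto simp: ae_eq_rel_def)
  qed
  have "f \<in> ae_eq_rel M `` {f}"
    using assms by (simp add: ae_eq_rel_def)
  then have "(\<lambda>g. \<integral>\<omega>. norm (g \<omega>) \<partial>M) ` (ae_eq_rel M `` {f}) = {\<integral>\<omega>. norm (f \<omega>) \<partial>M}"
    using * by (metis (no_types, lifting) empty_iff image_constant_conv image_cong)
  then show ?thesis
    by (simp add: L1_def)
qed

end

theory Submission imports Defs "HOL-Probability.Conditional_Expectation" begin

text \<open>
  An operator \<open>T\<close> on \<open>L\<^sub>1(\<mu>)\<close> is determined by the vector measure \<open>m(E) = T 1\<^sub>E\<close>.  Its averages
  \<open>m(E) / \<mu>(E)\<close> are images of points of the unit ball, so for a weakly compact \<open>T\<close> they lie in a
  weakly compact set \<open>K\<close>.  This forces \<open>m\<close> to have, up to any \<open>\<delta> > 0\<close>, a countably valued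
  density: \<open>\<Omega>\<close> splits into countably many pieces \<open>A\<^sub>j\<close> with
  \<open>\<parallel>m(E) - \<mu>(E) d\<^sub>j\<parallel> \<le> \<delta> \<mu>(E)\<close> for all \<open>E \<subseteq> A\<^sub>j\<close> (\<open>nearly_constant\<close>).  One of the pieces nearly
  carries the norm of \<open>T\<close>: there are \<open>A\<close> of positive measure and \<open>y\<close> such that \<open>m\<close> is within \<open>\<epsilon>\<close> of
  \<open>\<mu> y\<close> on \<open>A\<close> and \<open>\<parallel>T\<parallel> \<le> \<parallel>y\<parallel> + \<epsilon>\<close> (\<open>nearly_constant_norming_piece\<close>).

  Now lengthen \<open>y\<close> by \<open>2\<epsilon>\<close> to a vector \<open>z\<close> and let \<open>S f = T (1\<^bsub>\<Omega> - A\<^esub> f) + (\<integral>\<^sub>A f) z\<close>.  Then \<open>S\<close> is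
  within \<open>3\<epsilon>\<close> of \<open>T\<close>, and it is weakly compact because only a rank one operator was added to a
  restriction of \<open>T\<close>.  Outside \<open>A\<close> the norm of \<open>S\<close> is at most \<open>\<parallel>y\<parallel> + \<epsilon> < \<parallel>z\<parallel> = \<parallel>S\<parallel>\<close>, so a sequence
  in the ball with \<open>\<parallel>S f\<^sub>n\<parallel> \<rightarrow> \<parallel>S\<parallel>\<close> must push its whole mass into \<open>A\<close> and satisfy
  \<open>\<bar>\<integral>\<^sub>A f\<^sub>n\<bar> \<rightarrow> 1\<close>.  On \<open>A\<close> the operator sees nothing but that scalar; a convergent subsequence of the
  scalars gives \<open>S f\<^sub>n \<rightarrow> \<theta> z = \<theta> S(1\<^sub>A / \<mu>(A))\<close> (\<open>RSE_replace_on\<close>).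

  The pieces \<open>A\<^sub>j\<close> come from scalar Radon--Nikodym derivatives.  If the range of \<open>m\<close> is separable,
  countably many functionals \<open>\<phi>\<^sub>k\<close> norm its closed span.  With \<open>h\<^sub>k\<close> the density of \<open>\<phi>\<^sub>k \<circ> m\<close>, weak
  compactness provides for almost every \<open>\<omega>\<close> a point \<open>y \<in> K\<close> with \<open>\<phi>\<^sub>k y = h\<^sub>k(\<omega>)\<close> for all \<open>k\<close>
  (\<open>densities_attained\<close>), and countably many small balls cover the possible \<open>y\<close>.  Separability is
  automatic (\<open>totally_bounded_range\<close>): a sequence of values \<open>m(E\<^sub>n)\<close> lies in the range of \<open>m\<close> on the
  \<open>\<sigma>\<close>-algebra generated by the \<open>E\<^sub>n\<close>; that range is separable, hence by the separable case it is
  nearly a bounded subset of a finite-dimensional space, so the sequence has a Cauchy subsequence.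

  The converse inclusion says that the weakly compact operators are closed.  This is
  Grothendieck's criterion (\<open>weakly_compact_if_approximable\<close>), obtained from Tychonoff's theorem
  by embedding \<open>Y\<close> into a product of lines.  Both directions use real functionals only,
  since the weak topology of a complex space is that of the underlying real space.
\<close>

section \<open>The Hahn--Banach theorem\<close>

definition sublinear :: "('v::real_vector \<Rightarrow> real) \<Rightarrow> bool" where
  "sublinear p \<longleftrightarrow> (\<forall>x y. p (x + y) \<le> p x + p y) \<and> (\<forall>c>0. \<forall>x. p (c *\<^sub>R x) = c * p x)"

lemma sublinearI:
  assumes "\<And>x y. p (x + y) \<le> p x + p y" "\<And>c x. c > 0 \<Longrightarrow> p (c *\<^sub>R x) \<le> c * p x"
  shows "sublinear p"
  unfolding sublinear_def
proof (intro conjI allI impI)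
  fix c :: real and x :: 'a assume "c > 0"
  have "c * p x = c * p (inverse c *\<^sub>R c *\<^sub>R x)"
    using \<open>c > 0\<close> by simp
  also have "\<dots> \<le> c * (inverse c * p (c *\<^sub>R x))"
    using assms(2)[of "inverse c" "c *\<^sub>R x"] \<open>c > 0\<close> by (intro mult_left_mono) auto
  finally show "p (c *\<^sub>R x) = c * p x"
    using assms(2)[of c x] \<open>c > 0\<close> by (simp add: field_simps)
qed (use assms in auto)

lemma sublinear_add: "sublinear p \<Longrightarrow> p (x + y) \<le> p x + p y"
  by (simp add: sublinear_def)

lemma sublinear_scaleR: "sublinear p \<Longrightarrow> c \<ge> 0 \<Longrightarrow> p (c *\<^sub>R x) = c * p x"
proof -
  assume p: "sublinear p" and "c \<ge> 0"
  have "p (2 *\<^sub>R 0) = 2 * p 0" using p unfolding sublinear_def by (metis zero_less_numeral)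
  then have "p 0 = 0" by simp
  then show ?thesis using p \<open>c \<ge> 0\<close> by (cases "c = 0") (auto simp: sublinear_def)
qed

lemma sublinear_0: "sublinear p \<Longrightarrow> p 0 = 0"
  using sublinear_scaleR[of p 0 0] by simp

lemma sublinear_minus_le: "sublinear p \<Longrightarrow> - p (- x) \<le> p x"
  using sublinear_add[of p x "- x"] sublinear_0[of p] by simp

text \<open>
  A sublinear functional can always be lowered until it is odd in a given direction \<open>z\<close>.  So a
  minimal one is odd in every direction, and an odd sublinear functional is linear; that is the
  whole proof of Hahn--Banach below.  The witness is \<open>q x = (INF t\<ge>0. p (x + t z) - t p z)\<close>, where
  \<open>t = 0\<close> gives \<open>q \<le> p\<close> and \<open>t = 1\<close> gives \<open>q (- z) \<le> - p z\<close>.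
\<close>

lemma sublinear_tilt:
  assumes p: "sublinear p"
  obtains q where "sublinear q" "q \<le> p" "q (- z) \<le> - p z"
proof -
  define q where "q x = (INF t\<in>{0..}. p (x + t *\<^sub>R z) - t * p z)" for x
  have lb: "- p (- x) \<le> p (x + t *\<^sub>R z) - t * p z" if "t \<ge> 0" for x t
    using sublinear_add[OF p, of "x + t *\<^sub>R z" "- x"] sublinear_scaleR[OF p that, of z] by simp
  have bdd: "bdd_below ((\<lambda>t. p (x + t *\<^sub>R z) - t * p z) ` {0..})" for x
    using lb by (intro bdd_belowI[of _ "- p (- x)"]) auto
  have q_le: "q x \<le> p (x + t *\<^sub>R z) - t * p z" if "t \<ge> 0" for x t
    unfolding q_def using bdd that by (intro cINF_lower) auto
  have q_ge: "b \<le> q x" if "\<And>t. t \<ge> 0 \<Longrightarrow> b \<le> p (x + t *\<^sub>R z) - t * p z" for b x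
    unfolding q_def using that by (intro cINF_greatest) auto
  have "sublinear q"
  proof (rule sublinearI)
    fix x y
    have "q (x + y) - (p (y + t *\<^sub>R z) - t * p z) \<le> p (x + s *\<^sub>R z) - s * p z"
      if "s \<ge> 0" "t \<ge> 0" for s t
    proof -
      have "q (x + y) \<le> p ((x + s *\<^sub>R z) + (y + t *\<^sub>R z)) - (s + t) * p z"
        using q_le[of "s + t" "x + y"] that by (simp add: algebra_simps)
      then show ?thesis
        using sublinear_add[OF p, of "x + s *\<^sub>R z" "y + t *\<^sub>R z"] by (simp add: algebra_simps)
    qed
    then have "q (x + y) - (p (y + t *\<^sub>R z) - t * p z) \<le> q x" if "t \<ge> 0" for t
      using that by (intro q_ge) auto
    then have "q (x + y) - q x \<le> q y"
      by (intro q_ge) (simp add: algebra_simps)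
    then show "q (x + y) \<le> q x + q y" by simp
  next
    fix c :: real and x assume c: "c > 0"
    have "q (c *\<^sub>R x) / c \<le> p (x + t *\<^sub>R z) - t * p z" if "t \<ge> 0" for t
    proof -
      have "q (c *\<^sub>R x) \<le> p (c *\<^sub>R (x + t *\<^sub>R z)) - (c * t) * p z"
        using q_le[of "c * t" "c *\<^sub>R x"] c that by (simp add: algebra_simps)
      also have "\<dots> = c * (p (x + t *\<^sub>R z) - t * p z)"
        using sublinear_scaleR[OF p, of c "x + t *\<^sub>R z"] c by (simp add: right_diff_distrib)
      finally show ?thesis using c by (simp add: field_simps)
    qed
    then have "q (c *\<^sub>R x) / c \<le> q x" by (rule q_ge)
    then show "q (c *\<^sub>R x) \<le> c * q x" using c by (simp add: field_simps)
  qed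
  moreover have "q \<le> p" using q_le[of 0] by (auto simp: le_fun_def)
  moreover have "q (- z) \<le> - p z" using q_le[of 1 "- z"] sublinear_0[OF p] by simp
  ultimately show ?thesis by (rule that)
qed

text \<open>
  The pointwise infimum works: it is finite since all members are bounded below in terms of one of
  them, and for subadditivity two members can be replaced by the smaller one.
\<close>

lemma sublinear_chain_lower_bound:
  assumes C: "\<And>q. q \<in> C \<Longrightarrow> sublinear q" "\<And>q r. q \<in> C \<Longrightarrow> r \<in> C \<Longrightarrow> q \<le> r \<or> r \<le> q"
    and "C \<noteq> {}"
  shows "\<exists>q. sublinear q \<and> (\<forall>r\<in>C. q \<le> r)"
proof -
  obtain r0 where r0: "r0 \<in> C" using \<open>C \<noteq> {}\<close> by auto
  have "- r0 (- x) \<le> r x" if "r \<in> C" for r x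
  proof -
    have "- r (- x) \<le> r x" "- r0 (- x) \<le> r0 x"
      using sublinear_minus_le C(1) that r0 by blast+
    moreover have "r \<le> r0 \<or> r0 \<le> r" using C(2) that r0 by blast
    ultimately show ?thesis
      using le_funD[of r r0 "- x"] le_funD[of r0 r x] by auto
  qed
  then have bdd: "bdd_below ((\<lambda>r. r x) ` C)" for x
    by (intro bdd_belowI) auto
  define q where "q x = (INF r\<in>C. r x)" for x
  have q_le: "q x \<le> r x" if "r \<in> C" for r x
    unfolding q_def using bdd that by (intro cINF_lower) auto
  have q_ge: "b \<le> q x" if "\<And>r. r \<in> C \<Longrightarrow> b \<le> r x" for b x
    unfolding q_def using that \<open>C \<noteq> {}\<close> by (intro cINF_greatest) auto
  have "sublinear q"
  proof (rule sublinearI)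
    fix x y
    have "q (x + y) - s y \<le> r x" if "r \<in> C" "s \<in> C" for r s
    proof -
      have "r \<le> s \<or> s \<le> r" using C(2) that by blast
      define u where "u = (if r \<le> s then r else s)"
      have "u \<in> C" "u \<le> r" "u \<le> s"
        using that \<open>r \<le> s \<or> s \<le> r\<close> by (auto simp: u_def)
      then have "q (x + y) \<le> u x + u y" "u x \<le> r x" "u y \<le> s y"
        using q_le[of u "x + y"] sublinear_add[OF C(1), of u x y] by (auto simp: le_fun_def)
      then show ?thesis by simp
    qed
    then have "q (x + y) - s y \<le> q x" if "s \<in> C" for s
      using that by (intro q_ge) auto
    then have "q (x + y) - q x \<le> q y"
      by (intro q_ge) (simp add: algebra_simps)
    then show "q (x + y) \<le> q x + q y" by simp
  next
    fix c :: real and x assume c: "c > 0"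
    have "q (c *\<^sub>R x) / c \<le> q x"
    proof (rule q_ge)
      fix r assume "r \<in> C"
      then show "q (c *\<^sub>R x) / c \<le> r x"
        using q_le[of r "c *\<^sub>R x"] sublinear_scaleR[OF C(1), of r c x] c by (simp add: field_simps)
    qed
    then show "q (c *\<^sub>R x) \<le> c * q x" using c by (simp add: field_simps)
  qed
  then show ?thesis using q_le by (auto simp: le_fun_def)
qed

text \<open>
  Tilting \<open>p\<close> along \<open>z\<close> before minimising is what makes the linear functional agree with \<open>p\<close> at
  \<open>z\<close>.
\<close>

theorem hahn_banach_sublinear:
  fixes p :: "'v::real_vector \<Rightarrow> real"
  assumes p: "sublinear p"
  obtains f where "linear f" "\<And>x. f x \<le> p x" "f z = p z"
proof -
  obtain p' where p': "sublinear p'" "p' \<le> p" "p' (- z) \<le> - p z"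
    using sublinear_tilt[OF p] by blast
  define A where "A = {q. sublinear q \<and> q \<le> p'}"
  define R where "R = relation_of (\<lambda>q r. r \<le> q) A"
  have "partial_order_on A R"
    unfolding R_def by (rule partial_order_on_relation_ofI) auto
  moreover have "\<exists>u\<in>A. \<forall>r\<in>C. u \<le> r" if "C \<in> Chains R" for C
  proof (cases "C = {}")
    case True
    then show ?thesis using p'(1) by (auto simp: A_def)
  next
    case False
    have CA: "C \<subseteq> A" using that by (auto simp: Chains_def R_def relation_of_def)
    have "\<exists>q. sublinear q \<and> (\<forall>r\<in>C. q \<le> r)"
    proof (rule sublinear_chain_lower_bound[OF _ _ False])
      show "sublinear q" if "q \<in> C" for q using that CA by (auto simp: A_def)
      show "q \<le> r \<or> r \<le> q" if "q \<in> C" "r \<in> C" for q r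
        using \<open>C \<in> Chains R\<close> that unfolding Chains_def R_def relation_of_def by blast
    qed
    then obtain q where q: "sublinear q" "\<And>r. r \<in> C \<Longrightarrow> q \<le> r" by blast
    obtain r where "r \<in> C" using False by blast
    then have "q \<le> p'" using q(2) CA unfolding A_def by (blast intro: order_trans)
    then show ?thesis using q unfolding A_def by blast
  qed
  ultimately obtain f where f: "f \<in> A" "\<And>r. r \<in> A \<Longrightarrow> r \<le> f \<Longrightarrow> r = f"
    using predicate_Zorn[of A "\<lambda>q r. r \<le> q"] unfolding R_def by blast
  have sf: "sublinear f" and fp: "f \<le> p'" using f(1) by (auto simp: A_def)
  have odd: "f (- x) = - f x" for x
  proof -
    obtain q where "sublinear q" "q \<le> f" "q (- x) \<le> - f x"
      using sublinear_tilt[OF sf] by blast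
    moreover from this have "q = f" using f(2) fp by (auto simp: A_def)
    ultimately show ?thesis using sublinear_minus_le[OF sf, of x] by auto
  qed
  have "linear f"
  proof (rule linearI)
    fix x y
    show "f (x + y) = f x + f y"
      using sublinear_add[OF sf, of x y] sublinear_add[OF sf, of "- x" "- y"] odd[of "x + y"] odd
      by simp
  next
    fix c x
    show "f (c *\<^sub>R x) = c *\<^sub>R f x"
      using sublinear_scaleR[OF sf, of c x] sublinear_scaleR[OF sf, of "- c" x] odd[of "c *\<^sub>R x"]
      by (cases "c \<ge> 0") auto
  qed
  moreover have le: "f x \<le> p x" for x using fp p'(2) by (meson le_funD order_trans)
  moreover have "f z = p z"
    using le[of z] odd[of z] le_funD[OF fp, of "- z"] p'(3) by simp
  ultimately show ?thesis by (rule that)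
qed

lemma norming_functional:
  fixes z :: "'v::real_normed_vector"
  shows "\<exists>f :: 'v \<Rightarrow> real. bounded_linear f \<and> (\<forall>x. \<bar>f x\<bar> \<le> norm x) \<and> f z = norm z"
proof -
  have "sublinear (norm :: 'v \<Rightarrow> real)"
    by (rule sublinearI) (auto simp: norm_triangle_ineq)
  then obtain f :: "'v \<Rightarrow> real" where f: "linear f" "\<And>x. f x \<le> norm x" "f z = norm z"
    using hahn_banach_sublinear by blast
  have "\<bar>f x\<bar> \<le> norm x" for x
    using f(2)[of x] f(2)[of "- x"] linear_neg[OF f(1), of x] by simp
  moreover from this have "bounded_linear f"
    using f(1) by (intro bounded_linear.intro bounded_linear_axioms.intro) (auto intro: exI[of _ 1])
  ultimately show ?thesis using f(3) by blast
qed

text \<open>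
  The distance to \<open>S\<close> is sublinear, vanishes on \<open>S\<close> and is positive at \<open>z\<close>.
\<close>

lemma annihilating_functional:
  fixes S :: "'v::real_normed_vector set"
  assumes S: "subspace S" and z: "z \<notin> closure S"
  shows "\<exists>f :: 'v \<Rightarrow> real. bounded_linear f \<and> (\<forall>x\<in>S. f x = 0) \<and> f z \<noteq> 0"
proof -
  let ?p = "\<lambda>x. infdist x S"
  have ne: "S \<noteq> {}" using S subspace_0 by auto
  have approx: "\<exists>s\<in>S. dist x s < infdist x S + e" if "e > 0" for x e
    using that ne infdist_attains_inf
    by (metis cINF_less_iff bdd_below_image_dist infdist_notempty less_add_same_cancel1)
  have "sublinear ?p"
  proof (rule sublinearI)
    fix x y
    show "?p (x + y) \<le> ?p x + ?p y"
    proof (rule field_le_epsilon)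
      fix e :: real assume "e > 0"
      obtain s t where "s \<in> S" "dist x s < ?p x + e/2" "t \<in> S" "dist y t < ?p y + e/2"
        using approx[of "e/2"] \<open>e > 0\<close> by (metis half_gt_zero)
      moreover from this have "?p (x + y) \<le> dist (x + y) (s + t)"
        using S by (intro infdist_le subspace_add)
      ultimately show "?p (x + y) \<le> ?p x + ?p y + e"
        using dist_triangle_add[of x y s t] by simp
    qed
  next
    fix c :: real and x assume c: "c > 0"
    show "?p (c *\<^sub>R x) \<le> c * ?p x"
    proof (rule field_le_epsilon)
      fix e :: real assume "e > 0"
      obtain s where s: "s \<in> S" "dist x s < ?p x + e/c"
        using approx[of "e/c"] \<open>e > 0\<close> c by auto
      have "?p (c *\<^sub>R x) \<le> dist (c *\<^sub>R x) (c *\<^sub>R s)"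
        using s S by (intro infdist_le subspace_scale)
      also have "\<dots> = c * dist x s" using c by (simp add: dist_norm flip: scaleR_diff_right)
      also have "\<dots> \<le> c * (?p x + e/c)" using s c by (intro mult_left_mono) auto
      also have "\<dots> = c * ?p x + e" using c by (simp add: field_simps)
      finally show "?p (c *\<^sub>R x) \<le> c * ?p x + e" .
    qed
  qed
  then obtain f where f: "linear f" "\<And>x. f x \<le> ?p x" "f z = ?p z"
    using hahn_banach_sublinear by blast
  have "?p x \<le> norm x" for x using infdist_le[OF subspace_0[OF S], of x] by simp
  from this[of x for x] this[of "- x" for x] have "\<bar>f x\<bar> \<le> norm x" for x
    using f(2)[of x] f(2)[of "- x"] linear_neg[OF f(1), of x]
    by (simp add: abs_le_iff) (metis order_trans norm_minus_cancel)
  then have "bounded_linear f"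
    using f(1) by (intro bounded_linear.intro bounded_linear_axioms.intro) (auto intro: exI[of _ 1])
  moreover have "f x = 0" if "x \<in> S" for x
    using f(2)[of x] f(2)[of "- x"] linear_neg[OF f(1), of x] that subspace_neg[OF S that] by simp
  moreover have "f z \<noteq> 0" using f(3) z in_closure_iff_infdist_zero[OF ne, of z] by simp
  ultimately show ?thesis by blast
qed

section \<open>Weak compactness\<close>

text \<open>
  The weak topology given by the real functionals.  All compactness arguments take place here.
\<close>

abbreviation weak :: "'y::real_normed_vector topology" where
  "weak \<equiv> weak_topology (scaleR :: real \<Rightarrow> 'y \<Rightarrow> 'y)"

lemma topspace_weak_topology [simp]: "topspace (weak_topology smul) = UNIV"
proof -
  have "(\<lambda>_. 0) \<in> dual smul" by (simp add: dual_def)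
  then have "UNIV \<in> {\<phi> -` U | \<phi> U. \<phi> \<in> dual smul \<and> open U}"
    by (intro CollectI exI[of _ "\<lambda>_. 0"] exI[of _ UNIV]) auto
  then show ?thesis
    unfolding weak_topology_def topology_generated_by_topspace by blast
qed

lemma dual_scaleR: "dual (scaleR :: real \<Rightarrow> 'y \<Rightarrow> 'y) = {\<phi> :: 'y::real_normed_vector \<Rightarrow> real. bounded_linear \<phi>}"
  by (auto simp: dual_def linear_simps(5))

lemma continuous_map_dual: "\<phi> \<in> dual smul \<Longrightarrow> continuous_map (weak_topology smul) euclidean \<phi>"
proof -
  assume "\<phi> \<in> dual smul"
  then have "openin (weak_topology smul) (\<phi> -` U)" if "open U" for U
    unfolding weak_topology_def using that by (intro topology_generated_by_Basis) blast
  then show ?thesis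
    by (auto simp: continuous_map_def vimage_def)
qed

lemma continuous_map_into_weak_topology:
  assumes "\<And>\<phi>. \<phi> \<in> dual smul \<Longrightarrow> continuous_map X euclidean (\<lambda>x. \<phi> (g x))"
  shows "continuous_map X (weak_topology smul) g"
  unfolding weak_topology_def
proof (rule continuous_on_generated_topo)
  fix V assume "V \<in> {\<phi> -` U | \<phi> U. \<phi> \<in> dual smul \<and> open U}"
  then obtain \<phi> U where V: "V = \<phi> -` U" "\<phi> \<in> dual smul" "open U" by blast
  then have "openin X {x \<in> topspace X. \<phi> (g x) \<in> U}"
    using assms by (intro openin_continuous_map_preimage) auto
  then show "openin X (g -` V \<inter> topspace X)"
    by (simp add: V(1) vimage_def Int_def conj_commute)
next
  show "g ` topspace X \<subseteq> \<Union> {\<phi> -` U | \<phi> U. \<phi> \<in> dual smul \<and> open U}"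
    using topspace_weak_topology[of smul]
    unfolding weak_topology_def topology_generated_by_topspace by simp
qed

lemma continuous_map_functional:
  "bounded_linear \<phi> \<Longrightarrow> continuous_map weak euclidean (\<phi> :: 'y::real_normed_vector \<Rightarrow> real)"
  using continuous_map_dual[of \<phi> scaleR] by (simp add: dual_scaleR)

lemma continuous_map_into_weak:
  fixes g :: "'a \<Rightarrow> 'y::real_normed_vector"
  assumes "\<And>\<phi> :: 'y \<Rightarrow> real. bounded_linear \<phi> \<Longrightarrow> continuous_map X euclidean (\<lambda>x. \<phi> (g x))"
  shows "continuous_map X weak g"
  using assms by (intro continuous_map_into_weak_topology) (auto simp: dual_scaleR)

lemma topology_eq_if_continuous_id:
  assumes "topspace X = topspace Y" "continuous_map X Y (\<lambda>x. x)" "continuous_map Y X (\<lambda>x. x)"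
  shows "X = Y"
proof -
  have "openin X U \<longleftrightarrow> openin Y U" for U
  proof
    assume "openin X U"
    moreover from this have "{x \<in> topspace Y. x \<in> U} = U"
      using openin_subset assms(1) by fastforce
    ultimately show "openin Y U"
      using openin_continuous_map_preimage[OF assms(3), of U] by simp
  next
    assume "openin Y U"
    moreover from this have "{x \<in> topspace X. x \<in> U} = U"
      using openin_subset assms(1) by fastforce
    ultimately show "openin X U"
      using openin_continuous_map_preimage[OF assms(2), of U] by simp
  qed
  then show ?thesis by (simp add: topology_eq)
qed

lemma weak_topology_eq_weak:
  fixes smul :: "'k::{real_normed_field, euclidean_space} \<Rightarrow> 'y \<Rightarrow> 'y::real_normed_vector"
  assumes "\<And>u :: 'y \<Rightarrow> real. bounded_linear u \<Longrightarrow>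
    \<exists>\<phi>\<in>dual smul. \<exists>\<rho>. continuous_on UNIV \<rho> \<and> u = (\<lambda>y. \<rho> (\<phi> y))"
  shows "weak_topology smul = weak"
proof (rule topology_eq_if_continuous_id)
  show "continuous_map (weak_topology smul) weak (\<lambda>x. x)"
  proof (rule continuous_map_into_weak)
    fix u :: "'y \<Rightarrow> real" assume "bounded_linear u"
    then obtain \<phi> \<rho> where *: "\<phi> \<in> dual smul" "continuous_on UNIV \<rho>" "u = (\<lambda>y. \<rho> (\<phi> y))"
      using assms by blast
    have "continuous_map (weak_topology smul) euclidean (\<rho> \<circ> \<phi>)"
      using * by (intro continuous_map_compose[OF continuous_map_dual]) auto
    then show "continuous_map (weak_topology smul) euclidean (\<lambda>x. u x)"
      by (simp add: * o_def)
  qed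
  show "continuous_map weak (weak_topology smul) (\<lambda>x. x)"
  proof (rule continuous_map_into_weak_topology)
    fix \<phi> :: "'y \<Rightarrow> 'k" assume "\<phi> \<in> dual smul"
    then have "bounded_linear \<phi>" by (simp add: dual_def)
    then have "continuous_map weak euclidean (\<lambda>y. \<phi> y \<bullet> b)" for b
      by (intro continuous_map_functional bounded_linear_inner_left_comp)
    then have "continuous_map weak euclidean (\<lambda>y. (\<phi> y \<bullet> b) *\<^sub>R b)" for b
      using continuous_map_compose[of weak euclidean "\<lambda>y. \<phi> y \<bullet> b" euclidean "\<lambda>t. t *\<^sub>R b"]
      by (simp add: o_def continuous_intros)
    then have "continuous_map weak euclidean (\<lambda>y. \<Sum>b\<in>Basis. (\<phi> y \<bullet> b) *\<^sub>R b)"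
      by (intro continuous_map_sum) auto
    then show "continuous_map weak euclidean (\<lambda>x. \<phi> x)"
      by (simp add: euclidean_representation)
  qed
qed simp

lemma weak_topology_real:
  fixes smul :: "real \<Rightarrow> 'y \<Rightarrow> 'y::banach"
  assumes "banach_space_over smul"
  shows "weak_topology smul = weak"
proof -
  interpret banach_space_over smul by fact
  have "smul = scaleR" using smul_of_real by (auto simp: fun_eq_iff)
  then show ?thesis by simp
qed

text \<open>
  A real functional \<open>u\<close> is the real part of the complex functional \<open>y \<mapsto> u y - \<i> u (\<i> y)\<close>.
\<close>

lemma weak_topology_complex:
  fixes smul :: "complex \<Rightarrow> 'y \<Rightarrow> 'y::banach"
  assumes "banach_space_over smul"
  shows "weak_topology smul = weak"
proof (rule weak_topology_eq_weak)
  interpret banach_space_over smul by fact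
  fix u :: "'y \<Rightarrow> real" assume u: "bounded_linear u"
  interpret u: bounded_linear u by (rule u)
  define \<phi> where "\<phi> y = Complex (u y) (- u (smul \<i> y))" for y
  have i: "smul \<i> (r *\<^sub>R y) = r *\<^sub>R smul \<i> y" for r y
    by (simp add: mult.commute flip: smul_of_real)
  have "bounded_linear \<phi>"
  proof (rule bounded_linear_intro[of _ "2 * onorm u"])
    show "\<phi> (x + y) = \<phi> x + \<phi> y" for x y
      by (simp add: \<phi>_def complex_eq_iff u.add scale_right_distrib)
    show "\<phi> (r *\<^sub>R x) = r *\<^sub>R \<phi> x" for r x
      by (simp add: \<phi>_def complex_eq_iff u.scaleR i)
    show "norm (\<phi> x) \<le> norm x * (2 * onorm u)" for x
      using cmod_le[of "\<phi> x"] onorm[OF u, of x] onorm[OF u, of "smul \<i> x"]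
      by (simp add: \<phi>_def norm_smul algebra_simps)
  qed
  moreover have "\<phi> (smul c y) = c * \<phi> y" for c y
  proof -
    have "smul c y = smul (of_real (Re c)) y + smul (of_real (Im c)) (smul \<i> y)"
      unfolding scale_scale scale_left_distrib[symmetric]
      by (simp add: complex_eq[symmetric] mult.commute)
    then have c: "smul c y = Re c *\<^sub>R y + Im c *\<^sub>R smul \<i> y"
      by (simp only: smul_of_real)
    have "smul \<i> (smul \<i> y) = - y"
      by simp
    then show ?thesis
      by (simp add: c \<phi>_def complex_eq_iff u.add u.scaleR u.neg u.diff scale_right_distrib i algebra_simps)
  qed
  ultimately have "\<phi> \<in> dual smul" by (simp add: dual_def)
  then show "\<exists>\<phi>\<in>dual smul. \<exists>\<rho>. continuous_on UNIV \<rho> \<and> u = (\<lambda>y. \<rho> (\<phi> y))"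
    by (intro bexI[of _ \<phi>] exI[of _ Re]) (auto simp: \<phi>_def intro: continuous_intros)
qed


lemma Hausdorff_weak: "Hausdorff_space (weak :: 'y::real_normed_vector topology)"
  unfolding Hausdorff_space_def
proof (intro allI impI)
  fix x y :: 'y assume "x \<in> topspace weak \<and> y \<in> topspace weak \<and> x \<noteq> y"
  then have "x \<noteq> y" by simp
  obtain \<phi> :: "'y \<Rightarrow> real" where \<phi>: "bounded_linear \<phi>" "\<phi> (x - y) = norm (x - y)"
    using norming_functional[of "x - y"] by blast
  interpret bounded_linear \<phi> by fact
  have "\<phi> x \<noteq> \<phi> y" using \<phi>(2) \<open>x \<noteq> y\<close> by (auto simp: diff)
  then obtain U V where UV: "open U" "open V" "\<phi> x \<in> U" "\<phi> y \<in> V" "U \<inter> V = {}"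
    using hausdorff[OF \<open>\<phi> x \<noteq> \<phi> y\<close>] by blast
  have "openin weak {x. \<phi> x \<in> W}" if "open W" for W
    using openin_continuous_map_preimage[OF continuous_map_functional[OF \<phi>(1)], of W] that by simp
  then show "\<exists>U V. openin weak U \<and> openin weak V \<and> x \<in> U \<and> y \<in> V \<and> disjnt U V"
    using UV by (intro exI[of _ "{x. \<phi> x \<in> U}"] exI[of _ "{x. \<phi> x \<in> V}"])
      (auto simp: disjnt_def)
qed

lemma compactin_closure_of_subset:
  assumes "Hausdorff_space X" "compactin X K" "S \<subseteq> K"
  shows "compactin X (X closure_of S)" "X closure_of S \<subseteq> K"
proof -
  have "closedin X K" using assms by (simp add: compactin_imp_closedin)
  then show "X closure_of S \<subseteq> K" using assms(3) by (simp add: closure_of_minimal)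
  then show "compactin X (X closure_of S)"
    using closed_compactin[OF assms(2) _ closedin_closure_of] by blast
qed

lemma compactin_weak_sums:
  fixes A B :: "'y::real_normed_vector set"
  assumes "compactin weak A" "compactin weak B"
  shows "compactin weak {a + b | a b. a \<in> A \<and> b \<in> B}"
proof -
  have "continuous_map (prod_topology weak weak) (weak :: 'y topology) (\<lambda>p. fst p + snd p)"
  proof (rule continuous_map_into_weak)
    fix \<phi> :: "'y \<Rightarrow> real" assume \<phi>: "bounded_linear \<phi>"
    have "continuous_map (prod_topology weak weak) euclidean (\<lambda>p. \<phi> (fst p) + \<phi> (snd p))"
      using continuous_map_compose[OF continuous_map_fst continuous_map_functional[OF \<phi>]]
        continuous_map_compose[OF continuous_map_snd continuous_map_functional[OF \<phi>]]
      by (intro continuous_map_add) (simp_all add: o_def)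
    then show "continuous_map (prod_topology weak weak) euclidean (\<lambda>p. \<phi> (fst p + snd p))"
      using \<phi> by (simp add: linear_simps)
  qed
  moreover have "compactin (prod_topology weak weak) (A \<times> B)"
    using assms by (simp add: compactin_Times)
  ultimately have "compactin weak ((\<lambda>p. fst p + snd p) ` (A \<times> B))"
    by (rule image_compactin[rotated])
  also have "(\<lambda>p. fst p + snd p) ` (A \<times> B) = {a + b | a b. a \<in> A \<and> b \<in> B}"
    by force
  finally show ?thesis .
qed

lemma compact_imp_compactin_weak:
  fixes A :: "'y::real_normed_vector set"
  assumes "compact A"
  shows "compactin weak A"
proof -
  have "continuous_map euclidean (weak :: 'y topology) (\<lambda>x. x)"
    by (rule continuous_map_into_weak) (simp add: linear_continuous_on)
  moreover have "compactin euclidean A" using assms by simp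
  ultimately show ?thesis using image_compactin by fastforce
qed

text \<open>
  Mazur's theorem for subspaces: the closure is the intersection of the kernels of the functionals
  that annihilate \<open>S\<close>.
\<close>

lemma closedin_weak_closure_subspace:
  fixes S :: "'y::real_normed_vector set"
  assumes "subspace S"
  shows "closedin weak (closure S)"
proof -
  have "closure S = \<Inter> {{y. \<phi> y = 0} | \<phi> :: 'y \<Rightarrow> real. bounded_linear \<phi> \<and> (\<forall>s\<in>S. \<phi> s = 0)}"
    (is "_ = \<Inter> ?F")
  proof (intro equalityI subsetI InterI)
    fix y Z assume y: "y \<in> closure S" and "Z \<in> ?F"
    then obtain \<phi> :: "'y \<Rightarrow> real" where \<phi>: "bounded_linear \<phi>" "\<forall>s\<in>S. \<phi> s = 0" "Z = {y. \<phi> y = 0}"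
      by blast
    have "closed {y. \<phi> y = 0}"
      using \<phi>(1) by (intro closed_Collect_eq linear_continuous_on continuous_on_const)
    then show "y \<in> Z" using y \<phi> closure_minimal[of S "{y. \<phi> y = 0}"] by auto
  next
    fix y assume y: "y \<in> \<Inter> ?F"
    show "y \<in> closure S"
    proof (rule ccontr)
      assume "y \<notin> closure S"
      then obtain \<phi> :: "'y \<Rightarrow> real" where "bounded_linear \<phi>" "\<forall>s\<in>S. \<phi> s = 0" "\<phi> y \<noteq> 0"
        using annihilating_functional[OF assms] by blast
      then show False using y by blast
    qed
  qed
  also have "closedin weak (\<Inter> ?F)"
  proof (rule closedin_Inter)
    show "?F \<noteq> {}" by (auto intro!: exI[of _ "\<lambda>_. 0"])
    fix Z assume "Z \<in> ?F"
    then obtain \<phi> :: "'y \<Rightarrow> real" where \<phi>: "bounded_linear \<phi>" "Z = {y. \<phi> y = 0}" by blast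
    show "closedin weak Z"
      using closedin_continuous_map_preimage[OF continuous_map_functional[OF \<phi>(1)], of "{0}"]
      by (simp add: \<phi>(2))
  qed
  finally show ?thesis .
qed

text \<open>
  A countable system of equations is solvable in a weakly compact set as soon as its finite
  subsystems are approximately solvable there, by Cantor's intersection theorem.
\<close>

lemma weakly_compact_solves_countable_system:
  fixes \<phi> :: "nat \<Rightarrow> 'y::real_normed_vector \<Rightarrow> real"
  assumes K: "compactin weak K" and \<phi>: "\<And>k. bounded_linear (\<phi> k)"
    and approx: "\<And>n. \<exists>y\<in>K. \<forall>k\<le>n. \<bar>\<phi> k y - h k\<bar> \<le> 1 / real (Suc n)"
  shows "\<exists>y\<in>K. \<forall>k. \<phi> k y = h k"
proof -
  define C where "C n = {y \<in> K. \<forall>k\<le>n. \<bar>\<phi> k y - h k\<bar> \<le> 1 / real (Suc n)}" for n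
  have "(\<Inter>n. C n) \<noteq> {}"
  proof (rule compact_space_imp_nest)
    show "compact_space (subtopology weak K)" using K by (simp add: compact_space_subtopology)
    show "C n \<noteq> {}" for n using approx[of n] by (auto simp: C_def)
    show "decseq C"
    proof (rule decseq_SucI)
      fix n
      have "1 / real (Suc (Suc n)) \<le> 1 / real (Suc n)" by (simp add: field_simps)
      then show "C (Suc n) \<subseteq> C n"
        unfolding C_def using order_trans le_SucI by blast
    qed
    show "closedin (subtopology weak K) (C n)" for n
    proof -
      have cl: "closedin weak {y. \<phi> k y \<in> cball (h k) (1 / real (Suc n))}" for k
        using closedin_continuous_map_preimage[OF continuous_map_functional[OF \<phi>],
            of "cball (h k) (1 / real (Suc n))"] by simp
      have "closedin weak (\<Inter>k\<le>n. {y. \<phi> k y \<in> cball (h k) (1 / real (Suc n))})"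
        using cl by (intro closedin_INT) auto
      moreover have "C n = (\<Inter>k\<le>n. {y. \<phi> k y \<in> cball (h k) (1 / real (Suc n))}) \<inter> K"
        by (auto simp: C_def dist_real_def abs_minus_commute)
      ultimately show ?thesis by (auto simp: closedin_subtopology)
    qed
  qed
  then obtain y where y: "\<And>n. y \<in> C n" by blast
  have "\<phi> k y = h k" for k
  proof -
    have "\<bar>\<phi> k y - h k\<bar> \<le> e" if "e > 0" for e
    proof -
      obtain n where n: "1 / real (Suc n) < e" using nat_approx_posE[OF \<open>e > 0\<close>] by metis
      have "\<bar>\<phi> k y - h k\<bar> \<le> 1 / real (Suc (max n k))"
        using y[of "max n k"] by (simp add: C_def)
      also have "\<dots> \<le> 1 / real (Suc n)" by (simp add: field_simps)
      finally show ?thesis using n by simp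
    qed
    then show ?thesis by (metis abs_le_zero_iff eq_iff_diff_eq_0 field_le_epsilon add_0)
  qed
  then show ?thesis using y[of 0] by (auto simp: C_def)
qed

text \<open>
  The step at which completeness of \<open>Y\<close> enters: a function on the dual ball that is uniformly
  approximated by evaluations is itself an evaluation.  The approximating points form a Cauchy
  sequence because the norm is a supremum over the dual ball.
\<close>

lemma functional_representation_limit:
  fixes \<xi> :: "('y::banach \<Rightarrow> real) \<Rightarrow> real"
  assumes approx: "\<And>e. e > 0 \<Longrightarrow> \<exists>k. \<forall>\<phi>. bounded_linear \<phi> \<longrightarrow> (\<forall>x. \<bar>\<phi> x\<bar> \<le> norm x) \<longrightarrow> \<bar>\<xi> \<phi> - \<phi> k\<bar> \<le> e"
  shows "\<exists>k. \<forall>\<phi>. bounded_linear \<phi> \<longrightarrow> (\<forall>x. \<bar>\<phi> x\<bar> \<le> norm x) \<longrightarrow> \<xi> \<phi> = \<phi> k"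
proof -
  have "\<forall>n. \<exists>k. \<forall>\<phi>. bounded_linear \<phi> \<longrightarrow> (\<forall>x. \<bar>\<phi> x\<bar> \<le> norm x) \<longrightarrow> \<bar>\<xi> \<phi> - \<phi> k\<bar> \<le> 1 / real (Suc n)"
    using approx by simp
  then obtain k where k: "\<And>n \<phi>. bounded_linear \<phi> \<Longrightarrow> (\<And>x. \<bar>\<phi> x\<bar> \<le> norm x) \<Longrightarrow>
      \<bar>\<xi> \<phi> - \<phi> (k n)\<bar> \<le> 1 / real (Suc n)"
    by metis
  have dist: "norm (k m - k n) \<le> 1 / real (Suc m) + 1 / real (Suc n)" for m n
  proof -
    obtain \<phi> :: "'y \<Rightarrow> real" where \<phi>: "bounded_linear \<phi>" "\<forall>x. \<bar>\<phi> x\<bar> \<le> norm x"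
        "\<phi> (k m - k n) = norm (k m - k n)"
      using norming_functional[of "k m - k n"] by blast
    interpret bounded_linear \<phi> by fact
    show ?thesis using k[OF \<phi>(1), of m] k[OF \<phi>(1), of n] \<phi>(2) \<phi>(3) by (simp add: diff)
  qed
  have "Cauchy k"
  proof (rule CauchyI)
    fix e :: real assume "e > 0"
    then obtain N where N: "1 / real (Suc N) < e / 2" using nat_approx_posE[of "e/2"] half_gt_zero by metis
    have "norm (k m - k n) < e" if "m \<ge> N" "n \<ge> N" for m n
    proof -
      have "1 / real (Suc m) \<le> 1 / real (Suc N)" "1 / real (Suc n) \<le> 1 / real (Suc N)"
        using that by (simp_all add: field_simps)
      then show ?thesis using dist[of m n] N by linarith
    qed
    then show "\<exists>N. \<forall>m\<ge>N. \<forall>n\<ge>N. norm (k m - k n) < e" by blast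
  qed
  then obtain l where l: "k \<longlonglongrightarrow> l" using Cauchy_convergent convergent_def by blast
  have "\<xi> \<phi> = \<phi> l" if \<phi>: "bounded_linear \<phi>" "\<forall>x. \<bar>\<phi> x\<bar> \<le> norm x" for \<phi>
  proof -
    have "(\<lambda>n. \<phi> (k n)) \<longlonglongrightarrow> \<phi> l" using bounded_linear.tendsto[OF \<phi>(1) l] .
    moreover have "(\<lambda>n. \<phi> (k n)) \<longlonglongrightarrow> \<xi> \<phi>"
    proof (rule LIMSEQ_I)
      fix e :: real assume "e > 0"
      then obtain N where N: "1 / real (Suc N) < e" using nat_approx_posE by metis
      have "norm (\<phi> (k n) - \<xi> \<phi>) < e" if "n \<ge> N" for n
      proof -
        have "1 / real (Suc n) \<le> 1 / real (Suc N)" using that by (simp add: field_simps)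
        then show ?thesis using k[OF \<phi>(1), of n] \<phi>(2) N by (simp add: abs_minus_commute)
      qed
      then show "\<exists>N. \<forall>n\<ge>N. norm (\<phi> (k n) - \<xi> \<phi>) < e" by blast
    qed
    ultimately show ?thesis by (rule LIMSEQ_unique[rotated])
  qed
  then show ?thesis by blast
qed

text \<open>
  Grothendieck's criterion.  Evaluation \<open>J\<close> embeds \<open>Y\<close> into the product of lines indexed by the
  dual ball \<open>D\<close>.  The closure \<open>C\<close> of \<open>J ` S\<close> is compact by Tychonoff, so it suffices that \<open>C\<close>
  consists of evaluations.  A point of \<open>C\<close> stays uniformly \<open>e\<close>-close to an evaluation at a point of
  the compact set \<open>K\<close>, because the \<open>e\<close>-neighbourhood of \<open>J ` K\<close> is a projection along a compact
  factor and thus closed.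
\<close>

theorem weakly_compact_if_approximable:
  fixes S :: "'y::banach set"
  assumes approx: "\<And>e. e > 0 \<Longrightarrow> \<exists>K. compactin weak K \<and> (\<forall>s\<in>S. \<exists>k\<in>K. norm (s - k) \<le> e)"
  shows "compactin weak (weak closure_of S)"
proof -
  define D where "D = {\<phi> :: 'y \<Rightarrow> real. bounded_linear \<phi> \<and> (\<forall>x. \<bar>\<phi> x\<bar> \<le> norm x)}"
  define P where "P = product_topology (\<lambda>_ :: 'y \<Rightarrow> real. euclideanreal) D"
  define J where "J y = restrict (\<lambda>\<phi>. \<phi> y) D" for y :: 'y
  have D_diff: "\<phi> (x - y) = \<phi> x - \<phi> y" if "\<phi> \<in> D" for \<phi> x y
    using that by (simp add: D_def linear_simps)
  have D_le: "\<bar>\<phi> x\<bar> \<le> norm x" if "\<phi> \<in> D" for \<phi> x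
    using that by (simp add: D_def)
  have J_inj: "x = y" if "J x = J y" for x y
  proof -
    obtain \<phi> :: "'y \<Rightarrow> real" where "bounded_linear \<phi>" "\<forall>z. \<bar>\<phi> z\<bar> \<le> norm z"
      and \<phi>: "\<phi> (x - y) = norm (x - y)"
      using norming_functional[of "x - y"] by blast
    then have "\<phi> \<in> D" by (simp add: D_def)
    have "\<phi> x = \<phi> y" using fun_cong[OF that, of \<phi>] \<open>\<phi> \<in> D\<close> by (simp add: J_def)
    then show ?thesis using \<phi> D_diff[OF \<open>\<phi> \<in> D\<close>] by simp
  qed
  have zero: "(\<lambda>_. 0) \<in> D" by (simp add: D_def)
  define C where "C = P closure_of (J ` S)"
  have "\<exists>b. \<forall>s\<in>S. \<bar>\<phi> s\<bar> \<le> b" if \<phi>: "\<phi> \<in> D" for \<phi>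
  proof -
    obtain K where K: "compactin weak K" "\<forall>s\<in>S. \<exists>k\<in>K. norm (s - k) \<le> 1"
      using approx[of 1] by auto
    have "compactin euclidean (\<phi> ` K)"
      using image_compactin[OF K(1) continuous_map_functional] \<phi> by (simp add: D_def)
    then obtain b where b: "\<And>k. k \<in> K \<Longrightarrow> \<bar>\<phi> k\<bar> \<le> b"
      using compact_imp_bounded[of "\<phi> ` K"] by (auto simp: bounded_iff)
    have "\<bar>\<phi> s\<bar> \<le> b + 1" if "s \<in> S" for s
    proof -
      obtain k where k: "k \<in> K" "norm (s - k) \<le> 1" using K(2) \<open>s \<in> S\<close> by blast
      have "\<bar>\<phi> s - \<phi> k\<bar> \<le> 1" using order_trans[OF D_le[OF \<phi>] k(2)] by (simp add: D_diff[OF \<phi>])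
      then show ?thesis using b[OF k(1)] by linarith
    qed
    then show ?thesis by blast
  qed
  then obtain b where b: "\<And>\<phi> s. \<phi> \<in> D \<Longrightarrow> s \<in> S \<Longrightarrow> \<bar>\<phi> s\<bar> \<le> b \<phi>" by metis
  have "compactin P (PiE D (\<lambda>\<phi>. {- b \<phi>..b \<phi>}))"
    unfolding P_def compactin_PiE by simp
  moreover have "J ` S \<subseteq> PiE D (\<lambda>\<phi>. {- b \<phi>..b \<phi>})"
  proof
    fix \<zeta> assume "\<zeta> \<in> J ` S"
    then obtain s where s: "s \<in> S" "\<zeta> = J s" by blast
    show "\<zeta> \<in> PiE D (\<lambda>\<phi>. {- b \<phi>..b \<phi>})"
    proof (rule PiE_I)
      fix \<phi> assume "\<phi> \<in> D"
      then show "\<zeta> \<phi> \<in> {- b \<phi>..b \<phi>}" using b[of \<phi> s] s by (auto simp: J_def)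
    qed (simp add: s J_def)
  qed
  moreover have "Hausdorff_space P" by (simp add: P_def Hausdorff_space_product_topology)
  ultimately have C: "compactin P C"
    unfolding C_def by (rule compactin_closure_of_subset(1)[rotated])
  have "\<exists>y. J y = \<xi>" if \<xi>: "\<xi> \<in> C" for \<xi>
  proof -
    have "\<exists>k. \<forall>\<phi>. bounded_linear \<phi> \<longrightarrow> (\<forall>x. \<bar>\<phi> x\<bar> \<le> norm x) \<longrightarrow> \<bar>\<xi> \<phi> - \<phi> k\<bar> \<le> e" if "e > 0" for e
    proof -
      obtain K where K: "compactin weak K" "\<forall>s\<in>S. \<exists>k\<in>K. norm (s - k) \<le> e"
        using approx[OF \<open>e > 0\<close>] by auto
      define Q where "Q = prod_topology P (subtopology weak K)"
      define Z where "Z = (\<Inter>\<phi>\<in>D. {p \<in> topspace Q. fst p \<phi> - \<phi> (snd p) \<in> cball 0 e})"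
      have "closedin Q Z"
        unfolding Z_def
      proof (rule closedin_INT)
        show "D \<noteq> {}" using zero by blast
        fix \<phi> assume \<phi>: "\<phi> \<in> D"
        have "continuous_map P euclidean (\<lambda>\<xi>. \<xi> \<phi>)"
          using \<phi> unfolding P_def by (intro continuous_map_product_projection)
        from continuous_map_compose[OF continuous_map_fst this]
        have "continuous_map Q euclidean (\<lambda>p. fst p \<phi>)" by (simp add: Q_def o_def)
        moreover have "continuous_map (subtopology weak K) euclidean \<phi>"
          using \<phi> by (intro continuous_map_from_subtopology continuous_map_functional) (simp add: D_def)
        from continuous_map_compose[OF continuous_map_snd this]
        have "continuous_map Q euclidean (\<lambda>p. \<phi> (snd p))" by (simp add: Q_def o_def)
        ultimately have "continuous_map Q euclidean (\<lambda>p. fst p \<phi> - \<phi> (snd p))"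
          by (rule continuous_map_diff)
        then show "closedin Q {p \<in> topspace Q. fst p \<phi> - \<phi> (snd p) \<in> cball 0 e}"
          by (rule closedin_continuous_map_preimage) simp
      qed
      moreover have "closed_map Q P fst"
        unfolding Q_def using K(1)
        by (intro Abstract_Topological_Spaces.closed_map_fst) (simp add: compact_space_subtopology)
      ultimately have "closedin P (fst ` Z)" by (simp add: closed_map_def)
      moreover have "J ` S \<subseteq> fst ` Z"
      proof
        fix \<zeta> assume "\<zeta> \<in> J ` S"
        then obtain s where s: "s \<in> S" "\<zeta> = J s" by blast
        obtain k where k: "k \<in> K" "norm (s - k) \<le> e" using K(2) s(1) by blast
        have "\<bar>\<phi> s - \<phi> k\<bar> \<le> e" if "\<phi> \<in> D" for \<phi>
          using order_trans[OF D_le[OF that] k(2)] by (simp add: D_diff[OF that])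
        then have "(J s, k) \<in> Z"
          using k(1) zero by (auto simp: Z_def Q_def P_def J_def)
        then show "\<zeta> \<in> fst ` Z" using s(2) by force
      qed
      ultimately have "C \<subseteq> fst ` Z" unfolding C_def by (rule closure_of_minimal[rotated])
      then obtain k where "(\<xi>, k) \<in> Z" using \<xi> by force
      then have "\<bar>\<xi> \<phi> - \<phi> k\<bar> \<le> e" if "\<phi> \<in> D" for \<phi>
        using that by (auto simp: Z_def)
      then show ?thesis by (auto simp: D_def)
    qed
    then have "\<exists>k. \<forall>\<phi>. bounded_linear \<phi> \<longrightarrow> (\<forall>x. \<bar>\<phi> x\<bar> \<le> norm x) \<longrightarrow> \<xi> \<phi> = \<phi> k"
      by (rule functional_representation_limit)
    then obtain k where k: "\<And>\<phi>. \<phi> \<in> D \<Longrightarrow> \<xi> \<phi> = \<phi> k"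
      by (auto simp: D_def)
    have "\<xi> \<in> extensional D"
      using \<xi> closure_of_subset_topspace[of P "J ` S"] by (auto simp: C_def P_def PiE_def)
    then have "J k = \<xi>"
      using k by (auto simp: J_def fun_eq_iff extensional_def)
    then show ?thesis by blast
  qed
  then obtain g where g: "\<And>\<xi>. \<xi> \<in> C \<Longrightarrow> J (g \<xi>) = \<xi>" by metis
  have "continuous_map (subtopology P C) weak g"
  proof (rule continuous_map_into_weak)
    fix \<phi> :: "'y \<Rightarrow> real" assume \<phi>: "bounded_linear \<phi>"
    then obtain c where c: "c > 0" "\<And>x. \<bar>\<phi> x\<bar> \<le> norm x * c"
      using bounded_linear.pos_bounded[OF \<phi>] by auto
    \<comment> \<open>\<open>D\<close> contains only functionals of norm at most 1, so \<open>\<phi>\<close> is rescaled into it.\<close>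
    define \<psi> where "\<psi> x = \<phi> x / c" for x
    have "bounded_linear \<psi>" unfolding \<psi>_def by (rule bounded_linear_compose[OF bounded_linear_divide \<phi>])
    then have \<psi>: "\<psi> \<in> D" using c by (auto simp: D_def \<psi>_def field_simps)
    have "continuous_map (subtopology P C) euclidean (\<lambda>\<xi>. c * \<xi> \<psi>)"
      using \<psi> unfolding P_def
      by (intro continuous_map_real_mult_left continuous_map_from_subtopology continuous_map_product_projection)
    moreover have "c * \<xi> \<psi> = \<phi> (g \<xi>)" if "\<xi> \<in> C" for \<xi>
    proof -
      have "\<xi> \<psi> = \<psi> (g \<xi>)" using fun_cong[OF g[OF that], of \<psi>] \<psi> by (simp add: J_def)
      then show ?thesis using c(1) by (simp add: \<psi>_def)
    qed
    ultimately show "continuous_map (subtopology P C) euclidean (\<lambda>\<xi>. \<phi> (g \<xi>))"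
      by (rule continuous_map_eq) auto
  qed
  moreover have "compactin (subtopology P C) C"
    using C by (simp add: compactin_subtopology)
  ultimately have "compactin weak (g ` C)" by (rule image_compactin[rotated])
  moreover have "S \<subseteq> g ` C"
  proof
    fix s assume "s \<in> S"
    have "J ` S \<subseteq> topspace P" by (auto simp: P_def J_def)
    then have "J s \<in> C" unfolding C_def using closure_of_subset \<open>s \<in> S\<close> by blast
    moreover from this have "g (J s) = s" using g J_inj by blast
    ultimately show "s \<in> g ` C" by force
  qed
  ultimately show ?thesis using compactin_closure_of_subset(1) Hausdorff_weak by blast
qed

section \<open>Separable spans and countably generated algebras\<close>

text \<open>
  Rational linear combinations, encoded as lists of coefficient-vector pairs, so that addition is
  concatenation.
\<close>

lemma separable_span:
  fixes D :: "'y::real_normed_vector set"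
  assumes "countable D"
  obtains R where "countable R" "D \<subseteq> R" "subspace (closure R)"
proof -
  define f where "f l = (\<Sum>(q, x)\<leftarrow>l. (of_rat q :: real) *\<^sub>R (x :: 'y))" for l
  define R where "R = f ` lists (UNIV \<times> D)"
  have "countable R"
    unfolding R_def using assms by (intro countable_image countable_lists countable_SIGMA) auto
  moreover have "D \<subseteq> R"
  proof
    fix x assume "x \<in> D"
    then have "f [(1, x)] \<in> R" unfolding R_def by (intro imageI) auto
    then show "x \<in> R" by (simp add: f_def)
  qed
  moreover have "subspace (closure R)"
  proof -
    have 0: "0 \<in> R" unfolding R_def by (rule image_eqI[of _ _ "[]"]) (auto simp: f_def)
    have add: "x + y \<in> R" if "x \<in> R" "y \<in> R" for x y
    proof -
      obtain a b where "a \<in> lists (UNIV \<times> D)" "b \<in> lists (UNIV \<times> D)" "x = f a" "y = f b"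
        using \<open>x \<in> R\<close> \<open>y \<in> R\<close> unfolding R_def by blast
      then show ?thesis unfolding R_def by (intro image_eqI[of _ _ "a @ b"]) (auto simp: f_def)
    qed
    have scale: "of_rat q *\<^sub>R x \<in> R" if "x \<in> R" for q x
    proof -
      obtain a where a: "a \<in> lists (UNIV \<times> D)" "x = f a"
        using \<open>x \<in> R\<close> unfolding R_def by blast
      have "of_rat q *\<^sub>R f a = f (map (\<lambda>(p, x). (q * p, x)) a)"
        unfolding f_def by (induction a) (auto simp: scaleR_right_distrib of_rat_mult)
      moreover have "map (\<lambda>(p, x). (q * p, x)) a \<in> lists (UNIV \<times> D)"
        using a(1) by (induction a) auto
      ultimately show ?thesis unfolding R_def a(2) by blast
    qed
    have scale_cl: "of_rat q *\<^sub>R x \<in> closure R" if "x \<in> closure R" for q x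
    proof -
      have "(*\<^sub>R) (of_rat q) ` closure R \<subseteq> closure R"
        using scale closure_subset
        by (intro image_closure_subset continuous_intros) auto
      then show ?thesis using that by blast
    qed
    show ?thesis
    proof (rule subspaceI)
      show "0 \<in> closure R" using 0 closure_subset by blast
      fix x y assume x: "x \<in> closure R"
      show "x + y \<in> closure R" if y: "y \<in> closure R"
      proof -
        have "(\<lambda>p. fst p + snd p) ` closure (R \<times> R) \<subseteq> closure R"
          using add
          by (intro image_closure_subset continuous_intros) (auto intro!: subsetD[OF closure_subset])
        then show ?thesis using x y unfolding closure_Times by force
      qed
      fix c :: real
      have "(\<lambda>t. t *\<^sub>R x) ` closure \<rat> \<subseteq> closure R"
        using scale_cl[OF x]
        by (intro image_closure_subset continuous_intros) (auto simp: Rats_def)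
      then show "c *\<^sub>R x \<in> closure R" by (auto simp: Rats_closure_real)
    qed
  qed
  ultimately show ?thesis by (rule that)
qed

text \<open>
  The algebra is the union of an increasing sequence of countable families, each adding the
  complements and pairwise unions of the previous one.
\<close>

lemma countable_algebra:
  assumes "countable G" "G \<subseteq> Pow \<Omega>"
  obtains A where "countable A" "G \<subseteq> A" "algebra \<Omega> A" "A \<subseteq> sigma_sets \<Omega> G"
proof -
  define F where "F n = ((\<lambda>A. A \<union> (-) \<Omega> ` A \<union> (\<lambda>(a, b). a \<union> b) ` (A \<times> A)) ^^ n) (insert {} G)" for n
  have F_0: "F 0 = insert {} G" by (simp add: F_def)
  have F_Suc: "F (Suc n) = F n \<union> (-) \<Omega> ` F n \<union> (\<lambda>(a, b). a \<union> b) ` (F n \<times> F n)" for n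
    by (simp add: F_def)
  have mono: "mono F" by (rule incseq_SucI) (auto simp: F_Suc)
  have F_countable: "countable (F n)" for n
    by (induction n) (use assms(1) in \<open>auto simp: F_0 F_Suc\<close>)
  have F_sigma: "F n \<subseteq> sigma_sets \<Omega> G" for n
  proof (induction n)
    case (Suc n)
    then show ?case by (auto simp: F_Suc intro: sigma_sets.Compl sigma_sets_Un)
  qed (auto simp: F_0 sigma_sets.Empty)
  define A where "A = (\<Union>n. F n)"
  have "A \<subseteq> sigma_sets \<Omega> G" using F_sigma by (auto simp: A_def)
  moreover have "algebra \<Omega> A"
    unfolding algebra_iff_Un
  proof (intro conjI ballI)
    show "A \<subseteq> Pow \<Omega>" using \<open>A \<subseteq> sigma_sets \<Omega> G\<close> sigma_sets_into_sp[OF assms(2)] by blast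
    show "{} \<in> A" using F_0 by (auto simp: A_def)
    fix a assume a: "a \<in> A"
    then show "\<Omega> - a \<in> A" using F_Suc by (fastforce simp: A_def)
    fix b assume "b \<in> A"
    with a obtain n k where "a \<in> F n" "b \<in> F k" by (auto simp: A_def)
    then have "a \<in> F (max n k)" "b \<in> F (max n k)" using monoD[OF mono] max.cobounded1 max.cobounded2 by blast+
    then have "a \<union> b \<in> F (Suc (max n k))" by (auto simp: F_Suc)
    then show "a \<union> b \<in> A" by (auto simp: A_def)
  qed
  moreover have "countable A" using F_countable by (simp add: A_def)
  moreover have "G \<subseteq> A" using F_0 by (auto simp: A_def)
  ultimately show ?thesis using that by blast
qed

lemma (in finite_measure) algebra_approximation:
  assumes A: "algebra (space M) A" "A \<subseteq> sets M" and E: "E \<in> sigma_sets (space M) A" and "e > 0"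
  shows "\<exists>a\<in>A. measure M (E - a) + measure M (a - E) < e"
proof -
  interpret algebra "space M" A by (rule A(1))
  have sub: "sigma_sets (space M) A \<subseteq> sets M" using A(2) by (rule sets.sigma_sets_subset)
  show ?thesis using E \<open>e > 0\<close>
  proof (induction E arbitrary: e)
    case (Basic a)
    then show ?case by (intro bexI[of _ a]) auto
  next
    case Empty
    then show ?case by (intro bexI[of _ "{}"]) auto
  next
    case (Compl E)
    then obtain a where a: "a \<in> A" "measure M (E - a) + measure M (a - E) < e" by blast
    have "space M - E - (space M - a) = a - E" "space M - a - (space M - E) = E - a"
      using a(1) Compl(1) A(2) sub sets.sets_into_space by blast+
    then show ?case using a by (intro bexI[of _ "space M - a"]) auto
  next
    case (Union E)
    have E: "E i \<in> sets M" for i using Union(1) sub by blast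
    have "(\<lambda>n. measure M (\<Union>i<n. E i)) \<longlonglongrightarrow> measure M (\<Union>n. \<Union>i<n. E i)"
      using E by (intro finite_Lim_measure_incseq) (auto simp: incseq_def intro: less_le_trans)
    moreover have "(\<Union>n. \<Union>i<n. E i) = (\<Union>i. E i)" by auto
    ultimately have "\<exists>n. \<forall>k\<ge>n. norm (measure M (\<Union>i<k. E i) - measure M (\<Union>i. E i)) < e / 2"
      using \<open>e > 0\<close> by (intro LIMSEQ_D) auto
    then obtain n where "norm (measure M (\<Union>i<n. E i) - measure M (\<Union>i. E i)) < e / 2" by blast
    then have n: "measure M (\<Union>i. E i) - measure M (\<Union>i<n. E i) < e / 2"
      unfolding real_norm_def by linarith
    define \<eta> where "\<eta> = e / (2 * (real n + 1))"
    have "\<eta> > 0" using \<open>e > 0\<close> by (simp add: \<eta>_def)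
    then have "\<forall>i. \<exists>a\<in>A. measure M (E i - a) + measure M (a - E i) < \<eta>" using Union by blast
    then obtain a where a: "\<And>i. a i \<in> A" "\<And>i. measure M (E i - a i) + measure M (a i - E i) < \<eta>"
      by metis
    have aM: "a i \<in> sets M" for i using a A by blast
    let ?a = "\<Union>i<n. a i"
    have "(\<Union>i. E i) - ?a \<subseteq> ((\<Union>i. E i) - (\<Union>i<n. E i)) \<union> (\<Union>i<n. E i - a i)" by blast
    then have "measure M ((\<Union>i. E i) - ?a) \<le> measure M (((\<Union>i. E i) - (\<Union>i<n. E i)) \<union> (\<Union>i<n. E i - a i))"
      using E aM by (intro finite_measure_mono) auto
    also have "\<dots> \<le> measure M ((\<Union>i. E i) - (\<Union>i<n. E i)) + measure M (\<Union>i<n. E i - a i)"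
      using E aM by (intro measure_Un_le) auto
    also have "measure M ((\<Union>i. E i) - (\<Union>i<n. E i)) = measure M (\<Union>i. E i) - measure M (\<Union>i<n. E i)"
      using E by (intro finite_measure_Diff) auto
    also have "measure M (\<Union>i<n. E i - a i) \<le> (\<Sum>i<n. measure M (E i - a i))"
      using E aM by (intro measure_UNION_le) auto
    finally have 1: "measure M ((\<Union>i. E i) - ?a) < e / 2 + (\<Sum>i<n. measure M (E i - a i))"
      using n by linarith
    have "measure M (?a - (\<Union>i. E i)) \<le> measure M (\<Union>i<n. a i - E i)"
      using E aM by (intro finite_measure_mono) auto
    also have "\<dots> \<le> (\<Sum>i<n. measure M (a i - E i))"
      using E aM by (intro measure_UNION_le) auto
    finally have "measure M ((\<Union>i. E i) - ?a) + measure M (?a - (\<Union>i. E i))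
        < e / 2 + (\<Sum>i<n. measure M (E i - a i) + measure M (a i - E i))"
      using 1 by (simp add: sum.distrib)
    also have "(\<Sum>i<n. measure M (E i - a i) + measure M (a i - E i)) \<le> (\<Sum>i<n. \<eta>)"
      using a(2) by (intro sum_mono) (auto intro: less_imp_le)
    also have "(\<Sum>i<n. \<eta>) \<le> e / 2" using \<open>e > 0\<close> by (simp add: \<eta>_def field_simps)
    finally show ?case using a(1) by (intro bexI[of _ ?a]) auto
  qed
qed

section \<open>Vector measures with weakly compact averages\<close>

text \<open>
  Domination by \<open>\<mu>\<close> turns finite additivity into countable additivity.
\<close>

locale dominated_vector_measure = finite_measure M for M :: "'a measure" +
  fixes m :: "'a set \<Rightarrow> 'y::banach" and C :: real
  assumes add: "A \<in> sets M \<Longrightarrow> B \<in> sets M \<Longrightarrow> A \<inter> B = {} \<Longrightarrow> m (A \<union> B) = m A + m B"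
    and dominated: "A \<in> sets M \<Longrightarrow> norm (m A) \<le> C * measure M A"
    and C_nonneg: "0 \<le> C"
begin

definition averages :: "'y set" where
  "averages = {m A /\<^sub>R measure M A | A. A \<in> sets M \<and> measure M A > 0}"

lemma null: "A \<in> sets M \<Longrightarrow> measure M A = 0 \<Longrightarrow> m A = 0"
  using dominated[of A] by simp

lemma split: "A \<in> sets M \<Longrightarrow> B \<in> sets M \<Longrightarrow> m A = m (A \<inter> B) + m (A - B)"
  using add[of "A \<inter> B" "A - B"] by (auto simp: Int_Diff_Un)

lemma diff_le:
  assumes "A \<in> sets M" "B \<in> sets M"
  shows "norm (m A - m B) \<le> C * (measure M (A - B) + measure M (B - A))"
proof -
  have "m A - m B = m (A - B) - m (B - A)"
    using split[OF assms] split[OF assms(2,1)] by (simp add: Int_commute)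
  also have "norm \<dots> \<le> C * measure M (A - B) + C * measure M (B - A)"
    using dominated[of "A - B"] dominated[of "B - A"] assms
    by (intro order_trans[OF norm_triangle_ineq4] add_mono) auto
  finally show ?thesis by (simp add: distrib_left)
qed

lemma sum_disjoint:
  assumes "disjoint_family A" "\<And>j. A j \<in> sets M" "E \<in> sets M"
  shows "m E = (\<Sum>j<N::nat. m (E \<inter> A j)) + m (E - (\<Union>j<N. A j))"
proof (induction N)
  case (Suc N)
  have "A j \<inter> A N = {}" if "j < N" for j
    using disjoint_family_onD[OF assms(1), of j N] that by simp
  then have "(E - (\<Union>j<N. A j)) \<inter> A N = E \<inter> A N" by blast
  moreover have "E - (\<Union>j<N. A j) - A N = E - (\<Union>j<Suc N. A j)"
    by (auto simp: lessThan_Suc)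
  moreover have "E - (\<Union>j<N. A j) \<in> sets M" using assms by auto
  ultimately have "m (E - (\<Union>j<N. A j)) = m (E \<inter> A N) + m (E - (\<Union>j<Suc N. A j))"
    using split[OF _ assms(2)] by metis
  then show ?case using Suc by simp
qed simp

text \<open>
  The signed measure \<open>\<phi> \<circ> m\<close> becomes a finite positive measure when a multiple of \<open>\<mu>\<close> is added,
  and then the Radon--Nikodym theorem applies.
\<close>

lemma density:
  fixes \<phi> :: "'y \<Rightarrow> real"
  assumes \<phi>: "bounded_linear \<phi>"
  shows "\<exists>h. integrable M h \<and> (\<forall>A\<in>sets M. \<phi> (m A) = (LINT x:A|M. h x))"
proof -
  interpret \<phi>: bounded_linear \<phi> by fact
  obtain c where c: "c > 0" "\<And>y. \<bar>\<phi> y\<bar> \<le> norm y * c" using \<phi>.pos_bounded by auto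
  define D where "D = C * c"
  have \<nu>: "\<bar>\<phi> (m A)\<bar> \<le> D * measure M A" if "A \<in> sets M" for A
  proof -
    have "\<bar>\<phi> (m A)\<bar> \<le> norm (m A) * c" by (rule c(2))
    also have "\<dots> \<le> (C * measure M A) * c"
      using dominated[OF that] c(1) by (intro mult_right_mono) auto
    finally show ?thesis by (simp add: D_def mult_ac)
  qed
  define f where "f A = \<phi> (m A) + D * measure M A" for A
  have f_nonneg: "0 \<le> f A" and f_le: "f A \<le> 2 * D * measure M A" if "A \<in> sets M" for A
    using \<nu>[OF that] by (auto simp: f_def abs_le_iff)
  have f_add: "f (A \<union> B) = f A + f B" if "A \<in> sets M" "B \<in> sets M" "A \<inter> B = {}" for A B
    using that by (simp add: f_def add \<phi>.add finite_measure_Union distrib_left)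
  have pos: "positive (sets M) (\<lambda>A. ennreal (f A))"
    using \<nu>[of "{}"] by (auto simp: positive_def f_def)
  have ca: "countably_additive (sets M) (\<lambda>A. ennreal (f A))"
  proof (rule sets.empty_continuous_imp_countably_additive[OF pos])
    show "additive (sets M) (\<lambda>A. ennreal (f A))"
      by (auto simp: additive_def f_add f_nonneg ennreal_plus)
    fix A :: "nat \<Rightarrow> 'a set" assume A: "range A \<subseteq> sets M" "decseq A" "(\<Inter>i. A i) = {}"
    have "(\<lambda>i. f (A i)) \<longlonglongrightarrow> 0"
    proof (rule tendsto_sandwich[where f = "\<lambda>_. 0" and h = "\<lambda>i. 2 * D * measure M (A i)"])
      have "(\<lambda>i. 2 * D * measure M (A i)) \<longlonglongrightarrow> 2 * D * measure M (\<Inter>i. A i)"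
        by (intro tendsto_mult_left finite_Lim_measure_decseq A)
      then show "(\<lambda>i. 2 * D * measure M (A i)) \<longlonglongrightarrow> 0" by (simp add: A(3))
      show "\<forall>\<^sub>F i in sequentially. 0 \<le> f (A i)"
        using A(1) f_nonneg by auto
      show "\<forall>\<^sub>F i in sequentially. f (A i) \<le> 2 * D * measure M (A i)"
        using A(1) f_le by auto
    qed simp
    from tendsto_ennrealI[OF this] show "(\<lambda>i. ennreal (f (A i))) \<longlonglongrightarrow> 0" by simp
  qed simp
  define N where "N = measure_of (space M) (sets M) (\<lambda>A. ennreal (f A))"
  have sets_N: "sets N = sets M" and space_N: "space N = space M" by (simp_all add: N_def)
  have N: "emeasure N A = ennreal (f A)" if "A \<in> sets M" for A
    unfolding N_def by (rule emeasure_measure_of_sigma[OF _ pos ca that]) unfold_locales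
  have "finite_measure N"
    by (rule finite_measureI) (simp add: space_N N)
  moreover have "absolutely_continuous M N"
    unfolding absolutely_continuous_def
  proof
    fix A assume A: "A \<in> null_sets M"
    then have "f A = 0" using f_nonneg[of A] f_le[of A] by (auto simp: measure_eq_0_null_sets)
    then show "A \<in> null_sets N" using A N[of A] sets_N by (auto simp: null_sets_def)
  qed
  ultimately obtain g where g: "g \<in> borel_measurable M" "density M g = N"
    using Radon_Nikodym_finite_measure[OF _ sets_N] by blast
  have "(\<integral>\<^sup>+x. g x \<partial>M) \<noteq> \<infinity>"
  proof -
    have "(\<integral>\<^sup>+x. g x \<partial>M) = (\<integral>\<^sup>+x. g x * indicator (space M) x \<partial>M)"
      by (intro nn_integral_cong) simp
    also have "\<dots> = ennreal (f (space M))"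
      using emeasure_density[OF g(1), of "space M"] g(2) N[of "space M"] by simp
    finally show ?thesis by simp
  qed
  then have AE_fin: "AE x in M. g x \<noteq> \<infinity>"
    using g(1) by (intro nn_integral_PInf_AE)
  define k where "k x = enn2real (g x)" for x
  have k_meas: "k \<in> borel_measurable M" unfolding k_def[abs_def] using g(1) by simp
  have k_nonneg: "0 \<le> k x" for x by (simp add: k_def)
  have k_nn: "(\<integral>\<^sup>+x. ennreal (k x) * indicator A x \<partial>M) = ennreal (f A)" if "A \<in> sets M" for A
  proof -
    have "(\<integral>\<^sup>+x. ennreal (k x) * indicator A x \<partial>M) = (\<integral>\<^sup>+x. g x * indicator A x \<partial>M)"
      using AE_fin by (intro nn_integral_cong_AE) (auto simp: k_def less_top)
    then show ?thesis using emeasure_density[OF g(1) that] g(2) N[OF that] by simp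
  qed
  have k_int: "integrable M k"
  proof (rule integrableI_nonneg[OF k_meas])
    have "(\<integral>\<^sup>+x. ennreal (k x) \<partial>M) = (\<integral>\<^sup>+x. ennreal (k x) * indicator (space M) x \<partial>M)"
      by (intro nn_integral_cong) simp
    then show "(\<integral>\<^sup>+x. ennreal (k x) \<partial>M) < \<infinity>" using k_nn[of "space M"] by simp
  qed (simp add: k_def)
  have k_set: "(LINT x:A|M. k x) = f A" if "A \<in> sets M" for A
  proof -
    have "(LINT x:A|M. k x) = enn2real (\<integral>\<^sup>+x. ennreal (indicator A x *\<^sub>R k x) \<partial>M)"
      unfolding set_lebesgue_integral_def using k_meas that
      by (intro integral_eq_nn_integral borel_measurable_scaleR borel_measurable_indicator)
        (auto simp: k_nonneg)
    also have "(\<integral>\<^sup>+x. ennreal (indicator A x *\<^sub>R k x) \<partial>M) = (\<integral>\<^sup>+x. ennreal (k x) * indicator A x \<partial>M)"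
      by (intro nn_integral_cong) (auto simp: indicator_def)
    finally show ?thesis using k_nn[OF that] f_nonneg[OF that] by simp
  qed
  have "\<phi> (m A) = (LINT x:A|M. k x - D)" if "A \<in> sets M" for A
  proof -
    have "(LINT x:A|M. k x - D) = (LINT x:A|M. k x) - (LINT x:A|M. D)"
      by (intro set_integral_diff(2); unfold set_integrable_def; intro integrable_mult_indicator that)
        (use k_int in simp_all)
    also have "(LINT x:A|M. D) = D * measure M A"
      using that by (simp add: set_lebesgue_integral_def)
    finally show ?thesis using k_set[OF that] by (simp add: f_def)
  qed
  moreover have "integrable M (\<lambda>x. k x - D)" using k_int by simp
  ultimately show ?thesis by blast
qed


lemma density_mean_near:
  fixes h :: "'a \<Rightarrow> real"
  assumes h: "integrable M h" and W: "W \<in> sets M" and near: "\<And>\<omega>. \<omega> \<in> W \<Longrightarrow> \<bar>h \<omega> - q\<bar> \<le> r"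
  shows "\<bar>(LINT x:W|M. h x) - q * measure M W\<bar> \<le> r * measure M W"
proof -
  have int: "set_integrable M W h" "set_integrable M W (\<lambda>_. c :: real)" for c
    unfolding set_integrable_def using h W by (intro integrable_mult_indicator; simp)+
  have const: "(LINT x:W|M. c) = c * measure M W" for c :: real
    using W by (simp add: set_lebesgue_integral_def)
  have "(q - r) * measure M W \<le> (LINT x:W|M. h x)"
    unfolding const[symmetric] using near
    by (intro set_integral_mono int) (auto simp: abs_le_iff algebra_simps)
  moreover have "(LINT x:W|M. h x) \<le> (q + r) * measure M W"
    unfolding const[symmetric] using near
    by (intro set_integral_mono int) (auto simp: abs_le_iff algebra_simps)
  ultimately show ?thesis by (simp add: abs_le_iff algebra_simps)
qed

text \<open>
  If countably many scalar densities take values near a rational tuple on a set \<open>W\<close> of positive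
  measure, then the average of \<open>m\<close> over \<open>W\<close> solves the first finitely many equations up to a small
  error.  Almost every \<open>\<omega>\<close> avoids the countably many null sets among these \<open>W\<close>.
\<close>

lemma densities_attained:
  fixes \<phi> :: "nat \<Rightarrow> 'y \<Rightarrow> real"
  assumes K: "compactin weak K" "averages \<subseteq> K" and \<phi>: "\<And>k. bounded_linear (\<phi> k)"
    and h: "\<And>k. integrable M (h k)"
    and density: "\<And>k A. A \<in> sets M \<Longrightarrow> \<phi> k (m A) = (LINT x:A|M. h k x)"
  shows "AE \<omega> in M. \<exists>y\<in>K. \<forall>k. \<phi> k y = h k \<omega>"
proof -
  \<comment> \<open>half of the tolerance: once for the distance of the average, once for that of \<open>h k \<omega>\<close>\<close>
  define r where "r n = 1 / (2 * real (Suc n))" for n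
  have r_pos: "r n > 0" for n by (simp add: r_def)
  define W where "W n qs = {\<omega> \<in> space M. \<forall>k\<le>n. \<bar>h k \<omega> - of_rat (qs ! k)\<bar> < r n}" for n and qs :: "rat list"
  have [measurable]: "h k \<in> borel_measurable M" for k using h by auto
  have W_sets: "W n qs \<in> sets M" for n qs unfolding W_def by measurable
  define Z where "Z = (\<Union>(n, qs)\<in>{(n, qs). measure M (W n qs) = 0}. W n qs)"
  have "Z \<in> null_sets M"
    unfolding Z_def using W_sets
    by (intro null_sets_UN') (auto simp: measure_eq_0_null_sets intro!: null_setsI simp: emeasure_eq_measure)
  moreover have "\<exists>y\<in>K. \<forall>k. \<phi> k y = h k \<omega>" if \<omega>: "\<omega> \<in> space M - Z" for \<omega>
  proof (rule weakly_compact_solves_countable_system[OF K(1) \<phi>])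
    fix n
    have "\<exists>q. \<bar>h k \<omega> - of_rat q\<bar> < r n" for k
    proof -
      obtain x where "x \<in> \<rat>" "h k \<omega> - r n < x" "x < h k \<omega> + r n"
        using Rats_dense_in_real[of "h k \<omega> - r n" "h k \<omega> + r n"] r_pos[of n] by auto
      moreover from this obtain q where "x = of_rat q" by (auto simp: Rats_def)
      ultimately show ?thesis by (intro exI[of _ q]) (simp add: abs_less_iff)
    qed
    then obtain q where q: "\<And>k. \<bar>h k \<omega> - of_rat (q k)\<bar> < r n" by metis
    define qs where "qs = map q [0..<Suc n]"
    have qs: "qs ! k = q k" if "k \<le> n" for k using that by (simp add: qs_def del: upt_Suc)
    have "\<omega> \<in> W n qs" using \<omega> q qs by (simp add: W_def)
    then have "measure M (W n qs) \<noteq> 0" using \<omega> by (auto simp: Z_def)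
    then have pos: "measure M (W n qs) > 0" by (simp add: zero_less_measure_iff)
    define y where "y = m (W n qs) /\<^sub>R measure M (W n qs)"
    have "\<bar>\<phi> k y - h k \<omega>\<bar> \<le> 1 / real (Suc n)" if "k \<le> n" for k
    proof -
      have "\<bar>(LINT x:W n qs|M. h k x) - of_rat (qs ! k) * measure M (W n qs)\<bar> \<le> r n * measure M (W n qs)"
        using that by (intro density_mean_near h W_sets) (auto simp: W_def less_imp_le)
      then have "\<bar>\<phi> k (m (W n qs)) / measure M (W n qs) - of_rat (qs ! k)\<bar> \<le> r n"
        using pos by (simp add: density[OF W_sets] field_simps abs_le_iff)
      moreover have "\<phi> k y = \<phi> k (m (W n qs)) / measure M (W n qs)"
        unfolding y_def using \<phi>[of k] by (simp add: linear_simps field_simps)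
      moreover have "\<bar>h k \<omega> - of_rat (qs ! k)\<bar> < r n" using q qs[OF that] by simp
      moreover have "r n + r n = 1 / real (Suc n)" by (simp add: r_def field_simps)
      ultimately show ?thesis by linarith
    qed
    moreover have "y \<in> K" using K(2) pos W_sets unfolding averages_def y_def by blast
    ultimately show "\<exists>y\<in>K. \<forall>k\<le>n. \<bar>\<phi> k y - h k \<omega>\<bar> \<le> 1 / real (Suc n)" by blast
  qed
  ultimately show ?thesis by (intro AE_I'[of Z]) blast+
qed

text \<open>
  The pieces \<open>A\<close> partition the space up to a null set, and on each piece a density of \<open>m\<close>, if there
  were one, would stay within \<open>\<delta>\<close> of the value \<open>d j\<close>.
\<close>

definition nearly_constant_on :: "real \<Rightarrow> (nat \<Rightarrow> 'a set) \<Rightarrow> (nat \<Rightarrow> 'y) \<Rightarrow> bool" where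
  "nearly_constant_on \<delta> A d \<longleftrightarrow> disjoint_family A \<and> range A \<subseteq> sets M \<and>
     measure M (space M - (\<Union>j. A j)) = 0 \<and>
     (\<forall>j. \<forall>E\<in>sets M. E \<subseteq> A j \<longrightarrow> norm (m E - measure M E *\<^sub>R d j) \<le> \<delta> * measure M E)"

text \<open>
  A piece consists of the points \<open>\<omega>\<close> at which all densities \<open>h k\<close> of a norming sequence are
  \<open>\<delta>\<close>-close to the values \<open>\<phi> k (d j)\<close>, for \<open>d j\<close> running through a dense sequence.  Almost every
  \<open>\<omega>\<close> is in one of them, because its densities are the values of \<open>\<phi> k\<close> at a single vector.
\<close>

lemma nearly_constant_if_separable:
  assumes K: "compactin weak K" "averages \<subseteq> K"
    and D: "countable D" "m ` sets M \<subseteq> closure D" and "\<delta> > 0"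
  shows "\<exists>A d. nearly_constant_on \<delta> A d"
proof -
  obtain R where R: "countable R" "D \<subseteq> R" "subspace (closure R)"
    using separable_span[OF D(1)] by blast
  let ?Y = "closure R"
  have mY: "m E \<in> ?Y" if "E \<in> sets M" for E
    using D(2) closure_mono[OF R(2)] that by blast
  have av: "averages \<subseteq> ?Y"
    unfolding averages_def using mY subspace_scale[OF R(3)] by blast
  \<comment> \<open>shrinking \<open>K\<close> keeps the vectors found below inside the separable subspace \<open>?Y\<close>\<close>
  define K' where "K' = weak closure_of averages"
  have K': "compactin weak K'"
    unfolding K'_def using compactin_closure_of_subset(1)[OF Hausdorff_weak K] .
  have K'_av: "averages \<subseteq> K'"
    unfolding K'_def by (rule closure_of_subset) simp
  have K'_Y: "K' \<subseteq> ?Y"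
    unfolding K'_def using closedin_weak_closure_subspace[OF R(3)] av
    by (intro closure_of_minimal) simp_all
  have "R \<noteq> {}" using subspace_0[OF R(3)] by auto
  define d where "d = from_nat_into R"
  have d: "range d = R" unfolding d_def using \<open>R \<noteq> {}\<close> R(1) by (rule range_from_nat_into)
  have approx: "\<exists>j. norm (d j - y) < e" if y: "y \<in> ?Y" and e: "e > 0" for y e
  proof -
    obtain x where "x \<in> R" "dist x y < e" using y e by (auto simp: closure_approachable)
    then show ?thesis unfolding d[symmetric] dist_norm by blast
  qed
  have "\<forall>j. \<exists>f :: 'y \<Rightarrow> real. bounded_linear f \<and> (\<forall>x. \<bar>f x\<bar> \<le> norm x) \<and> f (d j) = norm (d j)"
    using norming_functional by blast
  then obtain \<phi> :: "nat \<Rightarrow> 'y \<Rightarrow> real" where \<phi>: "\<And>k. bounded_linear (\<phi> k)"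
      "\<And>k x. \<bar>\<phi> k x\<bar> \<le> norm x" "\<And>k. \<phi> k (d k) = norm (d k)"
    by metis
  have \<phi>_diff: "\<phi> k (x - y) = \<phi> k x - \<phi> k y" for k x y
    using \<phi>(1) by (simp add: linear_simps)
  have norming: "norm v \<le> c" if v: "v \<in> ?Y" and c: "\<And>k. \<bar>\<phi> k v\<bar> \<le> c" for v c
  proof (rule field_le_epsilon)
    fix e :: real assume "e > 0"
    then obtain j where j: "norm (d j - v) < e / 2" using approx[OF v, of "e/2"] by auto
    have "norm v \<le> norm (d j) + norm (d j - v)"
      by (metis norm_minus_commute norm_triangle_sub)
    also have "norm (d j) = \<phi> j v + \<phi> j (d j - v)" by (simp add: \<phi>_diff \<phi>(3))
    finally show "norm v \<le> c + e" using j c[of j] \<phi>(2)[of j "d j - v"] by linarith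
  qed
  have "\<forall>k. \<exists>h. integrable M h \<and> (\<forall>A\<in>sets M. \<phi> k (m A) = (LINT x:A|M. h x))"
    using density[OF \<phi>(1)] by blast
  then obtain h where h: "\<And>k. integrable M (h k)"
      "\<And>k A. A \<in> sets M \<Longrightarrow> \<phi> k (m A) = (LINT x:A|M. h k x)"
    by metis
  have [measurable]: "h k \<in> borel_measurable M" for k using h(1) by auto
  have AE: "AE \<omega> in M. \<exists>y\<in>K'. \<forall>k. \<phi> k y = h k \<omega>"
    by (rule densities_attained[OF K' K'_av \<phi>(1) h])
  define B where "B j = {\<omega> \<in> space M. \<forall>k. \<bar>h k \<omega> - \<phi> k (d j)\<bar> \<le> \<delta>}" for j
  have B: "B j \<in> sets M" for j unfolding B_def by measurable
  then have B_range: "range B \<subseteq> sets M" by blast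
  have "AE \<omega> in M. \<omega> \<in> (\<Union>j. B j)"
    using AE AE_space
  proof eventually_elim
    case (elim \<omega>)
    then obtain y where y: "y \<in> K'" "\<And>k. \<phi> k y = h k \<omega>" by blast
    obtain j where j: "norm (d j - y) < \<delta>" using approx y(1) K'_Y \<open>\<delta> > 0\<close> by blast
    have "\<bar>h k \<omega> - \<phi> k (d j)\<bar> \<le> \<delta>" for k
      using \<phi>(2)[of k "d j - y"] j by (simp add: \<phi>_diff y(2) abs_minus_commute)
    then show ?case using elim by (auto simp: B_def)
  qed
  then have "emeasure M (space M - (\<Union>j. B j)) = 0"
    using B by (subst AE_iff_measurable[symmetric, where P = "\<lambda>\<omega>. \<omega> \<in> (\<Union>j. B j)"]) auto
  then have null: "measure M (space M - (\<Union>j. B j)) = 0" by (simp add: measure_def)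
  have "nearly_constant_on \<delta> (disjointed B) d"
    unfolding nearly_constant_on_def
  proof (intro conjI allI ballI impI)
    show "disjoint_family (disjointed B)" by (rule disjoint_family_disjointed)
    show "range (disjointed B) \<subseteq> sets M" by (rule sets.range_disjointed_sets[OF B_range])
    show "measure M (space M - (\<Union>j. disjointed B j)) = 0"
      using null by (simp add: UN_disjointed_eq)
    fix j E assume E: "E \<in> sets M" "E \<subseteq> disjointed B j"
    have EB: "E \<subseteq> B j" using E(2) disjointed_subset[of B j] by (rule subset_trans)
    show "norm (m E - measure M E *\<^sub>R d j) \<le> \<delta> * measure M E"
    proof (rule norming)
      have "d j \<in> ?Y" using d closure_subset[of R] by auto
      then show "m E - measure M E *\<^sub>R d j \<in> ?Y"
        using mY[OF E(1)] R(3) by (intro subspace_diff subspace_scale)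
      fix k
      have "\<bar>(LINT x:E|M. h k x) - \<phi> k (d j) * measure M E\<bar> \<le> \<delta> * measure M E"
        using EB by (intro density_mean_near h(1) E(1)) (auto simp: B_def)
      moreover have "\<phi> k (m E - measure M E *\<^sub>R d j) = (LINT x:E|M. h k x) - \<phi> k (d j) * measure M E"
        using \<phi>(1)[of k] h(2)[OF E(1), of k] by (simp add: linear_simps)
      ultimately show "\<bar>\<phi> k (m E - measure M E *\<^sub>R d j)\<bar> \<le> \<delta> * measure M E" by simp
    qed
  qed
  then show ?thesis by blast
qed

lemma compact_bounded_combinations:
  fixes d :: "nat \<Rightarrow> 'y"
  shows "\<exists>Q. compact Q \<and> (\<forall>t. (\<forall>j<N. t j \<in> {0..c}) \<longrightarrow> (\<Sum>j<N. t j *\<^sub>R d j) \<in> Q)"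
proof (induction N)
  case 0
  show ?case by (intro exI[of _ "{0}"]) auto
next
  case (Suc N)
  then obtain Q where Q: "compact Q" "\<And>t. \<forall>j<N. t j \<in> {0..c} \<Longrightarrow> (\<Sum>j<N. t j *\<^sub>R d j) \<in> Q" by blast
  have "compact ((\<lambda>t. t *\<^sub>R d N) ` {0..c})"
    by (intro compact_continuous_image continuous_intros) auto
  then have "compact {x + y |x y. x \<in> Q \<and> y \<in> (\<lambda>t. t *\<^sub>R d N) ` {0..c}}"
    using Q(1) by (intro compact_sums)
  moreover have "(\<Sum>j<Suc N. t j *\<^sub>R d j) \<in> {x + y |x y. x \<in> Q \<and> y \<in> (\<lambda>t. t *\<^sub>R d N) ` {0..c}}"
    if "\<forall>j<Suc N. t j \<in> {0..c}" for t
  proof -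
    have "(\<Sum>j<N. t j *\<^sub>R d j) \<in> Q" "t N *\<^sub>R d N \<in> (\<lambda>t. t *\<^sub>R d N) ` {0..c}"
      using Q(2)[of t] that by auto
    then show ?thesis unfolding sum.lessThan_Suc by blast
  qed
  ultimately show ?case by blast
qed

text \<open>
  Up to a set of small measure, only finitely many pieces matter, and there \<open>m E\<close> is close to the
  combination of \<open>d 0, \<dots>, d (N - 1)\<close> with the bounded coefficients \<open>\<mu> (E \<inter> A j)\<close>.
\<close>

lemma totally_bounded_if_nearly_constant:
  assumes "\<And>\<delta>. \<delta> > 0 \<Longrightarrow> \<exists>A d. nearly_constant_on \<delta> A d"
  shows "Met_TC.mtotally_bounded (m ` sets M)"
  unfolding Met_TC.mtotally_bounded_def mball_eq_ball
proof (intro allI impI)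
  fix e :: real assume e: "e > 0"
  define c where "c = measure M (space M)"
  have c: "c \<ge> 0" by (simp add: c_def)
  define \<delta> where "\<delta> = e / (8 * (c + 1))"
  have "\<delta> > 0" using e c by (simp add: \<delta>_def)
  then obtain A d where "nearly_constant_on \<delta> A d" using assms by blast
  then have A: "disjoint_family A" "\<And>j. A j \<in> sets M" "measure M (space M - (\<Union>j. A j)) = 0"
      "\<And>j E. E \<in> sets M \<Longrightarrow> E \<subseteq> A j \<Longrightarrow> norm (m E - measure M E *\<^sub>R d j) \<le> \<delta> * measure M E"
    by (auto simp: nearly_constant_on_def)
  have "(\<lambda>N. measure M (space M - (\<Union>j<N. A j))) \<longlonglongrightarrow> measure M (\<Inter>N. space M - (\<Union>j<N. A j))"
    using A(2) by (intro finite_Lim_measure_decseq) (auto simp: decseq_def intro: less_le_trans)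
  moreover have "(\<Inter>N. space M - (\<Union>j<N. A j)) = space M - (\<Union>j. A j)" by auto
  ultimately have "(\<lambda>N. C * measure M (space M - (\<Union>j<N. A j))) \<longlonglongrightarrow> C * 0"
    using A(3) by (intro tendsto_mult_left) simp
  then have "\<exists>N0. \<forall>N\<ge>N0. norm (C * measure M (space M - (\<Union>j<N. A j)) - C * 0) < e / 8"
    using e by (intro LIMSEQ_D) auto
  then obtain N where "norm (C * measure M (space M - (\<Union>j<N. A j)) - C * 0) < e / 8" by blast
  then have N: "C * measure M (space M - (\<Union>j<N. A j)) < e / 8" by (simp add: abs_less_iff)
  obtain Q where Q: "compact Q" "\<And>t. \<forall>j<N. t j \<in> {0..c} \<Longrightarrow> (\<Sum>j<N. t j *\<^sub>R d j) \<in> Q"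
    using compact_bounded_combinations[of N c d] by blast
  have near: "\<exists>q\<in>Q. dist (m E) q < e / 4" if E: "E \<in> sets M" for E
  proof -
    define q where "q = (\<Sum>j<N. measure M (E \<inter> A j) *\<^sub>R d j)"
    have "q \<in> Q"
      unfolding q_def c_def by (rule Q(2)) (auto simp: c_def intro: bounded_measure)
    have "m E - q = (\<Sum>j<N. m (E \<inter> A j) - measure M (E \<inter> A j) *\<^sub>R d j) + m (E - (\<Union>j<N. A j))"
      using sum_disjoint[OF A(1,2) E, of N] by (simp add: q_def sum_subtractf)
    also have "norm \<dots> \<le> (\<Sum>j<N. \<delta> * measure M (E \<inter> A j)) + e / 8"
    proof (rule norm_triangle_le[OF add_mono])
      show "norm (\<Sum>j<N. m (E \<inter> A j) - measure M (E \<inter> A j) *\<^sub>R d j) \<le> (\<Sum>j<N. \<delta> * measure M (E \<inter> A j))"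
        using E A(2,4) by (intro sum_norm_le) auto
      have "norm (m (E - (\<Union>j<N. A j))) \<le> C * measure M (E - (\<Union>j<N. A j))"
        using E A(2) by (intro dominated) auto
      also have "\<dots> \<le> C * measure M (space M - (\<Union>j<N. A j))"
        using E A(2) C_nonneg sets.sets_into_space[OF E]
        by (intro mult_left_mono finite_measure_mono) auto
      finally show "norm (m (E - (\<Union>j<N. A j))) \<le> e / 8" using N by simp
    qed
    also have "(\<Sum>j<N. \<delta> * measure M (E \<inter> A j)) = \<delta> * measure M (\<Union>j<N. E \<inter> A j)"
    proof -
      have "disjoint_family_on (\<lambda>j. E \<inter> A j) {..<N}"
        using A(1) by (auto simp: disjoint_family_on_def)
      then have "measure M (\<Union>j<N. E \<inter> A j) = (\<Sum>j<N. measure M (E \<inter> A j))"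
        using E A(2) by (intro finite_measure_finite_Union) auto
      then show ?thesis by (simp add: sum_distrib_left)
    qed
    also have "\<dots> \<le> \<delta> * c"
      unfolding c_def using \<open>\<delta> > 0\<close> by (intro mult_left_mono bounded_measure) auto
    also have "\<delta> * c < e / 8" using e c by (simp add: \<delta>_def field_simps)
    finally have "dist (m E) q < e / 4" by (simp add: dist_norm)
    then show ?thesis using \<open>q \<in> Q\<close> by blast
  qed
  obtain F where F: "F \<subseteq> Q" "finite F" "Q \<subseteq> (\<Union>x\<in>F. ball x (e / 4))"
    by (rule compactE_image[OF Q(1), of Q "\<lambda>x. ball x (e / 4)"]) (use e in auto)
  have near_F: "\<exists>x\<in>F. dist y x < e / 2" if y: "y \<in> m ` sets M" for y
  proof -
    obtain E where E: "E \<in> sets M" "y = m E" using y by blast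
    obtain q where q: "q \<in> Q" "dist y q < e / 4" using near[OF E(1)] unfolding E(2) by blast
    obtain x where x: "x \<in> F" "dist x q < e / 4" using subsetD[OF F(3) q(1)] by auto
    have "dist y x < e / 2" using dist_triangle2[of y x q] q x by linarith
    then show ?thesis using x(1) by blast
  qed
  define g where "g x = (SOME y. y \<in> m ` sets M \<and> dist y x < e / 2)" for x
  define F' where "F' = g ` {x \<in> F. \<exists>y\<in>m ` sets M. dist y x < e / 2}"
  have g: "g x \<in> m ` sets M \<and> dist (g x) x < e / 2" if "y \<in> m ` sets M" "dist y x < e / 2" for x y
    unfolding g_def using that by (intro someI[of "\<lambda>y. y \<in> m ` sets M \<and> dist y x < e / 2" y]) simp
  have "finite F'" using F(2) by (simp add: F'_def)
  moreover have "F' \<subseteq> m ` sets M" using g by (force simp: F'_def)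
  moreover have "m ` sets M \<subseteq> (\<Union>x\<in>F'. ball x e)"
  proof
    fix y assume y: "y \<in> m ` sets M"
    then obtain x where x: "x \<in> F" "dist y x < e / 2" using near_F[OF y] by blast
    have "dist (g x) y < e" using g[OF y x(2)] x(2) dist_triangle2[of "g x" y x] by linarith
    moreover have "g x \<in> F'" using x y by (auto simp: F'_def)
    ultimately show "y \<in> (\<Union>x\<in>F'. ball x e)" by auto
  qed
  ultimately show "\<exists>F. finite F \<and> F \<subseteq> m ` sets M \<and> m ` sets M \<subseteq> (\<Union>x\<in>F. ball x e)" by blast
qed

text \<open>
  A given sequence of values only involves a countably generated
  \<open>\<sigma>\<close>-algebra, and \<open>m\<close> restricted to it has separable range since its sets are approximated in
  measure by those of a countable algebra.
\<close>

lemma totally_bounded_range: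
  assumes K: "compactin weak K" "averages \<subseteq> K"
  shows "Met_TC.mtotally_bounded (m ` sets M)"
  unfolding Met_TC.mtotally_bounded_sequentially
proof (intro conjI allI impI)
  fix \<sigma> :: "nat \<Rightarrow> 'y" assume "range \<sigma> \<subseteq> m ` sets M"
  then have "\<forall>n. \<exists>E\<in>sets M. \<sigma> n = m E" by blast
  then obtain E where E: "\<And>n. E n \<in> sets M" "\<And>n. \<sigma> n = m (E n)" by metis
  have E_Pow: "range E \<subseteq> Pow (space M)" using E(1) sets.sets_into_space by blast
  obtain \<A> where \<A>: "countable \<A>" "range E \<subseteq> \<A>" "algebra (space M) \<A>" "\<A> \<subseteq> sigma_sets (space M) (range E)"
    using countable_algebra[OF _ E_Pow] by (metis countable_image uncountable_def)
  have sigma_M: "sigma_sets (space M) (range E) \<subseteq> sets M"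
    using E(1) by (intro sets.sigma_sets_subset) blast
  define F where "F = sigma (space M) (range E)"
  define M' where "M' = restr_to_subalg M F"
  have sub: "subalgebra M F"
    using sigma_M E_Pow by (simp add: subalgebra_def F_def space_measure_of_conv)
  have sets_M': "sets M' = sigma_sets (space M) (range E)"
  proof -
    have "sets F = sigma_sets (space M) (range E)" unfolding F_def using E_Pow by simp
    then show ?thesis unfolding M'_def using sets_restr_to_subalg[OF sub] by simp
  qed
  have measure_M': "measure M' A = measure M A" if "A \<in> sets M'" for A
    using that emeasure_restr_to_subalg[OF sub, of A] sets_restr_to_subalg[OF sub]
    by (simp add: measure_def M'_def)
  have sets_sub: "A \<in> sets M" if "A \<in> sets M'" for A using that sigma_M sets_M' by blast
  interpret M': dominated_vector_measure M' m C
  proof (intro dominated_vector_measure.intro dominated_vector_measure_axioms.intro)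
    show "finite_measure M'" unfolding M'_def by (rule finite_measure_restr_to_subalg[OF sub]) unfold_locales
  qed (use add dominated C_nonneg sets_sub measure_M' in auto)
  have "M'.averages \<subseteq> averages"
    unfolding M'.averages_def averages_def using sets_sub measure_M' by force
  then have K': "M'.averages \<subseteq> K" using K(2) by blast
  have "m ` sets M' \<subseteq> closure (m ` \<A>)"
  proof (rule image_subsetI)
    fix B assume B: "B \<in> sets M'"
    have "\<exists>y\<in>m ` \<A>. dist y (m B) < e" if "e > 0" for e
    proof -
      have "B \<in> sigma_sets (space M) \<A>"
        using B sigma_sets_mono''[OF _ \<A>(2)] unfolding sets_M'
        by (metis (mono_tags) \<A>(2) sigma_sets_mono' subsetD)
      then obtain a where a: "a \<in> \<A>" "measure M (B - a) + measure M (a - B) < e / (C + 1)"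
        using algebra_approximation[OF \<A>(3) _, of B "e / (C + 1)"] \<A>(4) sigma_M C_nonneg \<open>e > 0\<close>
        by (metis add_nonneg_pos divide_pos_pos order_trans zero_less_one)
      have "norm (m B - m a) \<le> C * (measure M (B - a) + measure M (a - B))"
        using B a(1) \<A>(4) sigma_M sets_sub by (intro diff_le) auto
      also have "\<dots> \<le> C * (e / (C + 1))"
        using a(2) C_nonneg by (intro mult_left_mono) auto
      also have "\<dots> < e" using C_nonneg \<open>e > 0\<close> by (simp add: field_simps)
      finally show ?thesis using a(1) by (auto simp: dist_norm norm_minus_commute)
    qed
    then show "m B \<in> closure (m ` \<A>)" by (simp add: closure_approachable)
  qed
  moreover have "countable (m ` \<A>)" using \<A>(1) by simp
  ultimately have "Met_TC.mtotally_bounded (m ` sets M')"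
    using M'.totally_bounded_if_nearly_constant M'.nearly_constant_if_separable[OF K(1) K'] by blast
  moreover have "range \<sigma> \<subseteq> m ` sets M'"
    using E(2) by (auto simp: sets_M' intro!: imageI sigma_sets.Basic)
  ultimately show "\<exists>r. strict_mono r \<and> Met_TC.MCauchy (\<sigma> \<circ> r)"
    unfolding Met_TC.mtotally_bounded_sequentially by blast
qed simp

theorem nearly_constant:
  assumes K: "compactin weak K" "averages \<subseteq> K" and "\<delta> > 0"
  shows "\<exists>A d. nearly_constant_on \<delta> A d"
proof -
  have "\<forall>n. \<exists>F. finite F \<and> m ` sets M \<subseteq> (\<Union>x\<in>F. ball x (1 / real (Suc n)))"
    using totally_bounded_range[OF K] unfolding Met_TC.mtotally_bounded_def mball_eq_ball
    by (metis of_nat_0_less_iff zero_less_Suc zero_less_divide_1_iff)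
  then obtain F where F: "\<And>n. finite (F n)" "\<And>n. m ` sets M \<subseteq> (\<Union>x\<in>F n. ball x (1 / real (Suc n)))"
    by metis
  have "countable (\<Union>n. F n)" using F(1) by (simp add: countable_finite)
  moreover have "m ` sets M \<subseteq> closure (\<Union>n. F n)"
  proof
    fix y assume y: "y \<in> m ` sets M"
    have "\<exists>x\<in>(\<Union>n. F n). dist x y < e" if "e > 0" for e
    proof -
      obtain n where n: "1 / real (Suc n) < e" using nat_approx_posE[OF \<open>e > 0\<close>] by metis
      obtain x where "x \<in> F n" "dist x y < 1 / real (Suc n)" using F(2)[of n] y by auto
      then show ?thesis using n by (intro bexI[of _ x]) auto
    qed
    then show "y \<in> closure (\<Union>n. F n)" by (simp add: closure_approachable)
  qed
  ultimately show ?thesis using nearly_constant_if_separable[OF K _ _ \<open>\<delta> > 0\<close>] by blast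
qed

text \<open>
  The average over \<open>E\<close> is a convex combination, up to a vanishing remainder, of the averages over
  the sets \<open>E \<inter> A j\<close>.  So they cannot all be shorter.
\<close>

lemma large_average_on_piece:
  assumes A: "nearly_constant_on \<delta> A d" and E: "E \<in> sets M" and large: "norm (m E) > c * measure M E"
  shows "\<exists>j. norm (m (E \<inter> A j)) > c * measure M (E \<inter> A j)"
proof (rule ccontr)
  assume "\<not> ?thesis"
  then have le: "norm (m (E \<inter> A j)) \<le> c * measure M (E \<inter> A j)" for j by (simp add: not_less)
  have A: "disjoint_family A" "\<And>j. A j \<in> sets M" "measure M (space M - (\<Union>j. A j)) = 0"
    using A by (auto simp: nearly_constant_on_def)
  define r where "r N = measure M (E - (\<Union>j<N. A j))" for N :: nat
  have "r \<longlonglongrightarrow> measure M (\<Inter>N. E - (\<Union>j<N. A j))"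
    unfolding r_def using A(2) E
    by (intro finite_Lim_measure_decseq) (auto simp: decseq_def intro: less_le_trans)
  moreover have "(\<Inter>N. E - (\<Union>j<N. A j)) = E - (\<Union>j. A j)" by auto
  moreover have "measure M (E - (\<Union>j. A j)) \<le> measure M (space M - (\<Union>j. A j))"
    using A(2) sets.sets_into_space[OF E] by (intro finite_measure_mono) auto
  ultimately have r: "r \<longlonglongrightarrow> 0"
    using A(3) by (metis antisym measure_nonneg)
  have "norm (m E) \<le> c * (measure M E - r N) + C * r N" for N
  proof -
    have "norm (m E) \<le> (\<Sum>j<N. c * measure M (E \<inter> A j)) + C * r N"
      unfolding sum_disjoint[OF A(1,2) E, of N] r_def
      using le E A(2) by (intro norm_triangle_le[OF add_mono] sum_norm_le dominated) auto
    also have "(\<Sum>j<N. c * measure M (E \<inter> A j)) = c * measure M (\<Union>j<N. E \<inter> A j)"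
    proof -
      have "disjoint_family_on (\<lambda>j. E \<inter> A j) {..<N}"
        using A(1) by (auto simp: disjoint_family_on_def)
      then have "measure M (\<Union>j<N. E \<inter> A j) = (\<Sum>j<N. measure M (E \<inter> A j))"
        using E A(2) by (intro finite_measure_finite_Union) auto
      then show ?thesis by (simp add: sum_distrib_left)
    qed
    also have "measure M (\<Union>j<N. E \<inter> A j) = measure M E - r N"
    proof -
      have "E - (\<Union>j<N. E \<inter> A j) = E - (\<Union>j<N. A j)" by auto
      moreover have "measure M (E - (\<Union>j<N. E \<inter> A j)) = measure M E - measure M (\<Union>j<N. E \<inter> A j)"
        using E A(2) by (intro finite_measure_Diff) auto
      ultimately show ?thesis by (simp add: r_def)
    qed
    finally show ?thesis .
  qed
  moreover have "(\<lambda>N. c * (measure M E - r N) + C * r N) \<longlonglongrightarrow> c * (measure M E - 0) + C * 0"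
    by (intro tendsto_intros r)
  ultimately have "norm (m E) \<le> c * (measure M E - 0) + C * 0"
    by (intro LIMSEQ_le_const) auto
  then show False using large by simp
qed

text \<open>
  Start from a set \<open>E\<close> whose average has nearly the largest norm and intersect it with a piece on
  which the average is still that long.
\<close>

theorem nearly_constant_norming_piece:
  assumes K: "compactin weak K" "averages \<subseteq> K" and "\<epsilon> > 0" and space: "measure M (space M) > 0"
  shows "\<exists>A\<in>sets M. \<exists>y. measure M A > 0 \<and>
    (\<forall>E\<in>sets M. norm (m (E \<inter> A) - measure M (E \<inter> A) *\<^sub>R y) \<le> \<epsilon> * measure M (E \<inter> A)) \<and>
    (\<forall>E\<in>sets M. norm (m E) \<le> (norm y + \<epsilon>) * measure M E)"
proof -
  define \<delta> where "\<delta> = \<epsilon> / 2"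
  have \<delta>: "\<delta> > 0" using \<open>\<epsilon> > 0\<close> by (simp add: \<delta>_def)
  define R where "R = {norm (m E) / measure M E | E. E \<in> sets M \<and> measure M E > 0}"
  have R_ne: "R \<noteq> {}" using space by (auto simp: R_def)
  have "bdd_above R"
    using dominated by (intro bdd_aboveI[of _ C]) (auto simp: R_def field_simps)
  then have R_le: "norm (m E) / measure M E \<le> Sup R" if "E \<in> sets M" "measure M E > 0" for E
    using that by (intro cSup_upper) (auto simp: R_def)
  have Sup_le: "norm (m E) \<le> Sup R * measure M E" if "E \<in> sets M" for E
  proof (cases "measure M E = 0")
    case False
    then have "measure M E > 0" by (simp add: zero_less_measure_iff)
    with R_le[OF that this] show ?thesis by (simp add: field_simps)
  qed (simp add: null[OF that])
  have "\<exists>x\<in>R. Sup R - \<delta> < x" using \<delta> by (intro less_cSupD R_ne) simp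
  then obtain E where E: "E \<in> sets M" "measure M E > 0" "Sup R - \<delta> < norm (m E) / measure M E"
    by (auto simp: R_def)
  then have large: "norm (m E) > (Sup R - \<delta>) * measure M E" by (simp add: field_simps)
  obtain A d where A: "nearly_constant_on \<delta> A d" using nearly_constant[OF K \<delta>] by blast
  obtain j where j: "norm (m (E \<inter> A j)) > (Sup R - \<delta>) * measure M (E \<inter> A j)"
    using large_average_on_piece[OF A E(1) large] by blast
  have Aj: "A j \<in> sets M" using A by (auto simp: nearly_constant_on_def)
  have near: "norm (m F - measure M F *\<^sub>R d j) \<le> \<delta> * measure M F" if "F \<in> sets M" "F \<subseteq> A j" for F
    using A that by (auto simp: nearly_constant_on_def)
  define B where "B = E \<inter> A j"
  have B: "B \<in> sets M" using E(1) Aj by (simp add: B_def)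
  have "measure M B \<noteq> 0" using j null[OF B] by (auto simp: B_def)
  then have B_pos: "measure M B > 0" by (simp add: zero_less_measure_iff)
  have "(Sup R - \<delta>) * measure M B < norm (m B)" using j by (simp add: B_def)
  also have "norm (m B) \<le> norm (measure M B *\<^sub>R d j) + norm (m B - measure M B *\<^sub>R d j)"
    by (metis norm_triangle_sub)
  also have "\<dots> \<le> (norm (d j) + \<delta>) * measure M B"
    using near[OF B] by (simp add: B_def algebra_simps)
  finally have "Sup R - \<delta> < norm (d j) + \<delta>" using B_pos by simp
  then have "Sup R \<le> norm (d j) + \<epsilon>" by (simp add: \<delta>_def)
  then have "norm (m F) \<le> (norm (d j) + \<epsilon>) * measure M F" if "F \<in> sets M" for F
    using Sup_le[OF that] mult_right_mono[of "Sup R" "norm (d j) + \<epsilon>" "measure M F"] by simp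
  moreover have "norm (m (F \<inter> B) - measure M (F \<inter> B) *\<^sub>R d j) \<le> \<epsilon> * measure M (F \<inter> B)" if "F \<in> sets M" for F
  proof -
    have "norm (m (F \<inter> B) - measure M (F \<inter> B) *\<^sub>R d j) \<le> \<delta> * measure M (F \<inter> B)"
      using that B by (intro near) (auto simp: B_def)
    also have "\<dots> \<le> \<epsilon> * measure M (F \<inter> B)"
      using \<open>\<epsilon> > 0\<close> by (intro mult_right_mono) (auto simp: \<delta>_def)
    finally show ?thesis .
  qed
  ultimately show ?thesis using B B_pos by blast
qed

end

section \<open>Operators on integrable functions\<close>

abbreviation L1_class :: "'a measure \<Rightarrow> ('a \<Rightarrow> 'k) \<Rightarrow> ('a \<Rightarrow> 'k::{real_normed_field, banach, second_countable_topology}) set" where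
  "L1_class M f \<equiv> ae_eq_rel M `` {f}"

lemma points_L1: "points (L1 M) = {L1_class M f | f. integrable M f}"
  by (auto simp: L1_def quotient_def)

lemma L1_class_in_points: "integrable M f \<Longrightarrow> L1_class M f \<in> points (L1 M)"
  by (auto simp: points_L1)

lemma L1_class_eq:
  assumes "integrable M f" "integrable M g" "AE \<omega> in M. f \<omega> = g \<omega>"
  shows "L1_class M f = L1_class M g"
  using assms by (intro equiv_class_eq[OF equiv_ae_eq_rel]) (auto simp: ae_eq_rel_def)

lemma vnorm_L1_nonneg: "x \<in> points (L1 M) \<Longrightarrow> 0 \<le> vnorm (L1 M) x"
  by (auto simp: points_L1 vnorm_L1)

lemma unit_ball_L1: "unit_ball (L1 M) = {L1_class M f | f. integrable M f \<and> (\<integral>\<omega>. norm (f \<omega>) \<partial>M) \<le> 1}"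
  by (force simp: unit_ball_def points_L1 vnorm_L1)

lemma op_norm_upper:
  fixes D :: "('a \<Rightarrow> 'k::{real_normed_field, banach, second_countable_topology}) set \<Rightarrow> 'y::real_normed_vector"
  assumes D: "\<And>x. x \<in> points (L1 M) \<Longrightarrow> norm (D x) \<le> C * vnorm (L1 M) x" and x: "x \<in> unit_ball (L1 M)"
  shows "norm (D x) \<le> op_norm (L1 M) D"
  unfolding op_norm_def
proof (rule cSUP_upper[OF x])
  show "bdd_above ((\<lambda>x. norm (D x)) ` unit_ball (L1 M))"
  proof (intro bdd_aboveI2[of _ _ "\<bar>C\<bar>"])
    fix x :: "('a \<Rightarrow> 'k) set" assume x: "x \<in> unit_ball (L1 M)"
    then have x': "x \<in> points (L1 M)" "vnorm (L1 M) x \<le> 1" by (auto simp: unit_ball_def)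
    have "norm (D x) \<le> C * vnorm (L1 M) x" by (rule D[OF x'(1)])
    also have "\<dots> \<le> \<bar>C\<bar> * 1"
      using x'(2) vnorm_L1_nonneg[OF x'(1)] by (intro mult_mono) auto
    finally show "norm (D x) \<le> \<bar>C\<bar>" by simp
  qed
qed

lemma zero_in_unit_ball_L1: "L1_class M (\<lambda>_. 0) \<in> unit_ball (L1 M)"
  by (auto simp: unit_ball_L1 intro!: exI[of _ "\<lambda>_. 0"])

lemma op_norm_le:
  assumes "\<And>x. x \<in> unit_ball (L1 M) \<Longrightarrow> norm (D x) \<le> c"
  shows "op_norm (L1 M) D \<le> c"
  unfolding op_norm_def using assms zero_in_unit_ball_L1 by (intro cSUP_least) blast+

lemma (in finite_measure) integrable_indicator:
  "E \<in> sets M \<Longrightarrow> integrable M (indicator E :: 'a \<Rightarrow> 'b::{real_normed_field, banach, second_countable_topology})"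
  by (intro integrable_simple_function[OF simple_function_indicator]) simp_all

text \<open>
  An operator on \<open>L\<^sub>1(\<mu>)\<close> seen as a map of integrable functions.  Boundedness makes it insensitive
  to null sets (\<open>t_cong_AE\<close>), so it descends to equivalence classes (\<open>lift\<close>).
\<close>

locale L1_operator = finite_measure M + banach_space_over smul
  for M :: "'a measure" and smul :: "'k::{real_normed_field, euclidean_space} \<Rightarrow> 'y::banach \<Rightarrow> 'y" +
  fixes t :: "('a \<Rightarrow> 'k) \<Rightarrow> 'y"
  assumes t_add: "integrable M f \<Longrightarrow> integrable M g \<Longrightarrow> t (\<lambda>\<omega>. f \<omega> + g \<omega>) = t f + t g"
    and t_scale: "integrable M f \<Longrightarrow> t (\<lambda>\<omega>. c * f \<omega>) = smul c (t f)"
    and t_bounded: "\<exists>C. \<forall>f. integrable M f \<longrightarrow> norm (t f) \<le> C * (\<integral>\<omega>. norm (f \<omega>) \<partial>M)"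
begin

lemma t_zero: "t (\<lambda>_. 0) = 0"
  using t_scale[of "\<lambda>_. 0" 0] by simp

lemma t_diff: "integrable M f \<Longrightarrow> integrable M g \<Longrightarrow> t (\<lambda>\<omega>. f \<omega> - g \<omega>) = t f - t g"
  using t_add[of "\<lambda>\<omega>. f \<omega> - g \<omega>" g] by simp

lemma t_sum: "finite I \<Longrightarrow> (\<And>i. i \<in> I \<Longrightarrow> integrable M (f i)) \<Longrightarrow> t (\<lambda>\<omega>. \<Sum>i\<in>I. f i \<omega>) = (\<Sum>i\<in>I. t (f i))"
  by (induction I rule: finite_induct) (simp_all add: t_zero t_add)

lemma t_bound: obtains C where "0 \<le> C" "\<And>f. integrable M f \<Longrightarrow> norm (t f) \<le> C * (\<integral>\<omega>. norm (f \<omega>) \<partial>M)"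
proof -
  obtain C where C: "\<And>f. integrable M f \<Longrightarrow> norm (t f) \<le> C * (\<integral>\<omega>. norm (f \<omega>) \<partial>M)"
    using t_bounded by blast
  have "norm (t f) \<le> \<bar>C\<bar> * (\<integral>\<omega>. norm (f \<omega>) \<partial>M)" if "integrable M f" for f
    by (rule order_trans[OF C[OF that]]) (intro mult_right_mono, auto)
  then show ?thesis using that[of "\<bar>C\<bar>"] by simp
qed

lemma t_cong_AE:
  assumes "integrable M f" "integrable M g" "AE \<omega> in M. f \<omega> = g \<omega>"
  shows "t f = t g"
proof -
  obtain C where C: "\<And>f. integrable M f \<Longrightarrow> norm (t f) \<le> C * (\<integral>\<omega>. norm (f \<omega>) \<partial>M)"
    using t_bound by blast
  have "(\<integral>\<omega>. norm (f \<omega> - g \<omega>) \<partial>M) = (\<integral>\<omega>. 0 \<partial>M)"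
    using assms by (intro integral_cong_AE) auto
  then have "norm (t f - t g) \<le> 0"
    using C[of "\<lambda>\<omega>. f \<omega> - g \<omega>"] assms by (simp add: t_diff)
  then show ?thesis by simp
qed

definition lift :: "('a \<Rightarrow> 'k) set \<Rightarrow> 'y" where
  "lift = (\<lambda>x\<in>points (L1 M). t (SOME f. f \<in> x))"

lemma lift_L1_class:
  assumes f: "integrable M f"
  shows "lift (L1_class M f) = t f"
proof -
  have "f \<in> L1_class M f" using f by (simp add: ae_eq_rel_def)
  then have "(SOME g. g \<in> L1_class M f) \<in> L1_class M f" by (rule someI[of "\<lambda>g. g \<in> L1_class M f"])
  then have "t (SOME g. g \<in> L1_class M f) = t f"
    by (intro t_cong_AE) (auto simp: ae_eq_rel_def)
  then show ?thesis using L1_class_in_points[OF f] by (simp add: lift_def)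
qed

lemma lift_bounded_operator: "lift \<in> bounded_operators (L1 M) smul"
  unfolding bounded_operators_def
proof (intro CollectI conjI ballI allI)
  show "lift \<in> extensional (points (L1 M))" by (simp add: lift_def)
  fix x assume "x \<in> points (L1 M :: ('k, ('a \<Rightarrow> 'k) set) normed_space)"
  then obtain f where f: "x = L1_class M f" "integrable M f" by (auto simp: points_L1)
  show "lift (vscale (L1 M) c x) = smul c (lift x)" for c
    using f by (simp add: vscale_L1 lift_L1_class t_scale)
  fix x' assume "x' \<in> points (L1 M :: ('k, ('a \<Rightarrow> 'k) set) normed_space)"
  then obtain g where g: "x' = L1_class M g" "integrable M g" by (auto simp: points_L1)
  show "lift (vadd (L1 M) x x') = lift x + lift x'"
    using f g by (simp add: vadd_L1 lift_L1_class t_add)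
next
  obtain C where "\<And>f. integrable M f \<Longrightarrow> norm (t f) \<le> C * (\<integral>\<omega>. norm (f \<omega>) \<partial>M)"
    using t_bound by blast
  then show "\<exists>C. \<forall>x\<in>points (L1 M). norm (lift x) \<le> C * vnorm (L1 M) x"
    by (intro exI[of _ C]) (auto simp: points_L1 vnorm_L1 lift_L1_class)
qed

lemma norm_simple_function_le:
  assumes c: "\<And>E. E \<in> sets M \<Longrightarrow> norm (t (indicator E)) \<le> c * measure M E"
    and s: "simple_function M s"
  shows "norm (t s) \<le> c * (\<integral>\<omega>. norm (s \<omega>) \<partial>M)"
proof -
  define V where "V = s ` space M"
  define E where "E v = s -` {v} \<inter> space M" for v
  have V: "finite V" using s by (simp add: V_def simple_function_def)
  have E: "E v \<in> sets M" for v using s unfolding E_def by (rule simple_functionD(2))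
  note int_ind = integrable_indicator[OF E]
  have sum_eq: "(\<Sum>v\<in>V. g v * indicator (E v) \<omega>) = g (s \<omega>)"
    if \<omega>: "\<omega> \<in> space M" for \<omega> and g :: "'k \<Rightarrow> 'b::real_normed_field"
  proof -
    have "(\<Sum>v\<in>V. g v * indicator (E v) \<omega>) = (\<Sum>v\<in>V. if v = s \<omega> then g (s \<omega>) else 0)"
      using \<omega> by (intro sum.cong) (auto simp: E_def indicator_def)
    then show ?thesis using V \<omega> by (simp add: V_def)
  qed
  have int_s: "integrable M s"
    using s by (rule integrable_simple_function) simp
  have "t s = t (\<lambda>\<omega>. \<Sum>v\<in>V. v * indicator (E v) \<omega>)"
    using int_s int_ind sum_eq[of _ "\<lambda>v. v"] by (intro t_cong_AE Bochner_Integration.integrable_sum) (auto intro: AE_I2)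
  also have "\<dots> = (\<Sum>v\<in>V. smul v (t (indicator (E v))))"
    using int_ind V by (subst t_sum) (auto simp: t_scale)
  also have "norm \<dots> \<le> (\<Sum>v\<in>V. norm v * (c * measure M (E v)))"
    using c E by (intro sum_norm_le) (auto simp: norm_smul intro: mult_left_mono)
  also have "\<dots> = c * (\<Sum>v\<in>V. \<integral>\<omega>. norm v * indicator (E v) \<omega> \<partial>M)"
    using E by (simp add: sum_distrib_left mult_ac)
  also have "(\<Sum>v\<in>V. \<integral>\<omega>. norm v * indicator (E v) \<omega> \<partial>M) = (\<integral>\<omega>. (\<Sum>v\<in>V. norm v * indicator (E v) \<omega>) \<partial>M)"
    using int_ind by (intro Bochner_Integration.integral_sum[symmetric]) auto
  also have "\<dots> = (\<integral>\<omega>. norm (s \<omega>) \<partial>M)"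
    using sum_eq[of _ norm] by (intro Bochner_Integration.integral_cong) auto
  finally show ?thesis .
qed

text \<open>
  The norm of an operator on \<open>L\<^sub>1(\<mu>)\<close> is determined by indicator functions: by the triangle
  inequality the bound passes to simple functions, which are dense.
\<close>

theorem norm_le_if_indicator_le:
  assumes c: "\<And>E. E \<in> sets M \<Longrightarrow> norm (t (indicator E)) \<le> c * measure M E"
    and f: "integrable M f"
  shows "norm (t f) \<le> c * (\<integral>\<omega>. norm (f \<omega>) \<partial>M)"
proof -
  obtain C where C: "0 \<le> C" "\<And>f. integrable M f \<Longrightarrow> norm (t f) \<le> C * (\<integral>\<omega>. norm (f \<omega>) \<partial>M)"
    using t_bound by blast
  have "f \<in> borel_measurable M" using f by simp
  then obtain F where "\<forall>i. simple_function M (F i)" "\<forall>\<omega>\<in>space M. (\<lambda>i. F i \<omega>) \<longlonglongrightarrow> f \<omega>"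
      "\<forall>i. \<forall>\<omega>\<in>space M. dist (F i \<omega>) 0 \<le> 2 * dist (f \<omega>) 0"
    using borel_measurable_implies_sequence_metric[of f M 0] by blast
  then obtain s where s: "\<And>i. simple_function M (s i)" "\<And>\<omega>. \<omega> \<in> space M \<Longrightarrow> (\<lambda>i. s i \<omega>) \<longlonglongrightarrow> f \<omega>"
      "\<And>i \<omega>. \<omega> \<in> space M \<Longrightarrow> norm (s i \<omega>) \<le> 2 * norm (f \<omega>)"
    unfolding dist_0_norm dist_norm diff_0_right by metis
  have int_s: "integrable M (s i)" for i using s(1) by (rule integrable_simple_function) simp
  have [measurable]: "s i \<in> borel_measurable M" for i using int_s by auto
  have [measurable]: "f \<in> borel_measurable M" using f by auto
  have 1: "(\<lambda>i. \<integral>\<omega>. norm (f \<omega> - s i \<omega>) \<partial>M) \<longlonglongrightarrow> (\<integral>\<omega>. 0 \<partial>M)"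
  proof (rule integral_dominated_convergence)
    show "integrable M (\<lambda>\<omega>. 3 * norm (f \<omega>))" using f by simp
    show "AE \<omega> in M. (\<lambda>i. norm (f \<omega> - s i \<omega>)) \<longlonglongrightarrow> 0"
    proof (rule AE_I2)
      fix \<omega> assume "\<omega> \<in> space M"
      then show "(\<lambda>i. norm (f \<omega> - s i \<omega>)) \<longlonglongrightarrow> 0"
        using tendsto_norm[OF tendsto_diff[OF tendsto_const s(2)], of \<omega> "f \<omega>"] by simp
    qed
    show "AE \<omega> in M. norm (norm (f \<omega> - s i \<omega>)) \<le> 3 * norm (f \<omega>)" for i
    proof (rule AE_I2)
      fix \<omega> assume "\<omega> \<in> space M"
      then show "norm (norm (f \<omega> - s i \<omega>)) \<le> 3 * norm (f \<omega>)"
        using s(3)[of \<omega> i] norm_triangle_ineq4[of "f \<omega>" "s i \<omega>"] by simp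
    qed
  qed measurable
  have 2: "(\<lambda>i. \<integral>\<omega>. norm (s i \<omega>) \<partial>M) \<longlonglongrightarrow> (\<integral>\<omega>. norm (f \<omega>) \<partial>M)"
  proof (rule integral_dominated_convergence)
    show "integrable M (\<lambda>\<omega>. 2 * norm (f \<omega>))" using f by simp
    show "AE \<omega> in M. (\<lambda>i. norm (s i \<omega>)) \<longlonglongrightarrow> norm (f \<omega>)"
      using s(2) by (intro AE_I2 tendsto_norm)
    show "AE \<omega> in M. norm (norm (s i \<omega>)) \<le> 2 * norm (f \<omega>)" for i
      using s(3) by (intro AE_I2) simp
  qed measurable
  have "norm (t f) \<le> c * (\<integral>\<omega>. norm (s i \<omega>) \<partial>M) + C * (\<integral>\<omega>. norm (f \<omega> - s i \<omega>) \<partial>M)" for i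
  proof -
    have "norm (t f) \<le> norm (t (s i)) + norm (t f - t (s i))" by (metis norm_triangle_sub)
    also have "t f - t (s i) = t (\<lambda>\<omega>. f \<omega> - s i \<omega>)" using f int_s by (simp add: t_diff)
    finally show ?thesis
      using norm_simple_function_le[OF c s(1), of i] C(2)[of "\<lambda>\<omega>. f \<omega> - s i \<omega>"] f int_s by force
  qed
  moreover have "(\<lambda>i. c * (\<integral>\<omega>. norm (s i \<omega>) \<partial>M) + C * (\<integral>\<omega>. norm (f \<omega> - s i \<omega>) \<partial>M))
      \<longlonglongrightarrow> c * (\<integral>\<omega>. norm (f \<omega>) \<partial>M) + C * (\<integral>\<omega>. 0 \<partial>M)"
    by (intro tendsto_intros 1 2)
  ultimately have "norm (t f) \<le> c * (\<integral>\<omega>. norm (f \<omega>) \<partial>M) + C * (\<integral>\<omega>. 0 \<partial>M)"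
    by (intro LIMSEQ_le_const) auto
  then show ?thesis by simp
qed

end

lemma L1_operator_if_bounded_operator:
  fixes smul :: "'k::{real_normed_field, euclidean_space} \<Rightarrow> 'y::banach \<Rightarrow> 'y"
  assumes "finite_measure M" "banach_space_over smul" and T: "T \<in> bounded_operators (L1 M) smul"
  shows "L1_operator M smul (\<lambda>f. T (L1_class M f))"
proof (intro L1_operator.intro L1_operator_axioms.intro assms)
  have T: "\<And>x x'. x \<in> points (L1 M) \<Longrightarrow> x' \<in> points (L1 M) \<Longrightarrow> T (vadd (L1 M) x x') = T x + T x'"
      "\<And>c x. x \<in> points (L1 M) \<Longrightarrow> T (vscale (L1 M) c x) = smul c (T x)"
      "\<exists>C. \<forall>x\<in>points (L1 M). norm (T x) \<le> C * vnorm (L1 M) x"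
    using T by (auto simp: bounded_operators_def)
  show "T (L1_class M (\<lambda>\<omega>. f \<omega> + g \<omega>)) = T (L1_class M f) + T (L1_class M g)"
    if "integrable M f" "integrable M g" for f g
    using T(1)[of "L1_class M f" "L1_class M g"] that by (simp add: vadd_L1 L1_class_in_points)
  show "T (L1_class M (\<lambda>\<omega>. c * f \<omega>)) = smul c (T (L1_class M f))" if "integrable M f" for c f
    using T(2)[of "L1_class M f" c] that by (simp add: vscale_L1 L1_class_in_points)
  show "\<exists>C. \<forall>f. integrable M f \<longrightarrow> norm (T (L1_class M f)) \<le> C * (\<integral>\<omega>. norm (f \<omega>) \<partial>M)"
    using T(3) by (metis L1_class_in_points vnorm_L1)
qed

section \<open>Approximation by range strongly exposing operators\<close>

lemma (in banach_space_over) bounded_linear_smul_left: "bounded_linear (\<lambda>c. smul c y)"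
proof (rule bounded_linear_intro[of _ "norm y"])
  show "smul (c + d) y = smul c y + smul d y" for c d by (rule scale_left_distrib)
  show "smul (r *\<^sub>R c) y = r *\<^sub>R smul c y" for r c
    by (simp add: scaleR_conv_of_real smul_of_real flip: scale_scale)
qed (simp add: norm_smul)

text \<open>
  If mass outside a set is worth only \<open>\<tau> < r\<close> per unit, then a value close to \<open>r\<close> leaves almost no
  mass outside.
\<close>

lemma mass_concentrates:
  fixes a b q :: "nat \<Rightarrow> real"
  assumes a: "\<And>n. 0 \<le> a n" and ab: "\<And>n. a n + b n \<le> 1"
    and q: "\<And>n. q n \<le> \<tau> * a n + r * b n" "q \<longlonglongrightarrow> r" and \<tau>: "0 \<le> \<tau>" "\<tau> < r"
  shows "a \<longlonglongrightarrow> 0" "b \<longlonglongrightarrow> 1"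
proof -
  have "a n \<le> (r - q n) / (r - \<tau>)" for n
  proof -
    have "r * b n \<le> r * (1 - a n)" using ab[of n] \<tau> by (intro mult_left_mono) auto
    then show ?thesis using q(1)[of n] \<tau> by (simp add: field_simps)
  qed
  moreover have "(\<lambda>n. (r - q n) / (r - \<tau>)) \<longlonglongrightarrow> (r - r) / (r - \<tau>)"
    using \<tau> by (intro tendsto_intros q(2)) auto
  ultimately show 1: "a \<longlonglongrightarrow> 0"
    using a by (intro tendsto_sandwich[where f = "\<lambda>_. 0" and g = a and h = "\<lambda>n. (r - q n) / (r - \<tau>)"]) auto
  have "(q n - \<tau> * a n) / r \<le> b n" for n
    using q(1)[of n] \<tau> by (simp add: field_simps)
  moreover have "b n \<le> 1" for n using ab[of n] a[of n] by linarith
  moreover have "(\<lambda>n. (q n - \<tau> * a n) / r) \<longlonglongrightarrow> (r - \<tau> * 0) / r"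
    using \<tau> by (intro tendsto_intros q(2) 1) auto
  ultimately show "b \<longlonglongrightarrow> 1"
    using \<tau> by (intro tendsto_sandwich[where f = "\<lambda>n. (q n - \<tau> * a n) / r" and g = b and h = "\<lambda>_. 1"]) auto
qed

context L1_operator
begin

lemma integrable_indicator_mult:
  fixes f :: "'a \<Rightarrow> 'k"
  assumes "E \<in> sets M" "integrable M f"
  shows "integrable M (\<lambda>\<omega>. indicator E \<omega> * f \<omega>)"
proof -
  have "integrable M (\<lambda>\<omega>. indicator E \<omega> *\<^sub>R f \<omega>)" using assms by (rule integrable_mult_indicator)
  also have "(\<lambda>\<omega>. indicator E \<omega> *\<^sub>R f \<omega>) = (\<lambda>\<omega>. indicator E \<omega> * f \<omega>)"
    by (auto simp: fun_eq_iff indicator_def)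
  finally show ?thesis .
qed

lemma dominated_vector_measure_indicator: "\<exists>C. dominated_vector_measure M (\<lambda>E. t (indicator E)) C"
proof -
  obtain C where C: "0 \<le> C" "\<And>f. integrable M f \<Longrightarrow> norm (t f) \<le> C * (\<integral>\<omega>. norm (f \<omega>) \<partial>M)"
    using t_bound by blast
  have "dominated_vector_measure M (\<lambda>E. t (indicator E)) C"
  proof unfold_locales
    fix A B assume AB: "A \<in> sets M" "B \<in> sets M" "A \<inter> B = {}"
    have "(indicator (A \<union> B) :: 'a \<Rightarrow> 'k) = (\<lambda>\<omega>. indicator A \<omega> + indicator B \<omega>)"
      using AB(3) by (auto simp: fun_eq_iff indicator_def)
    then show "t (indicator (A \<union> B)) = t (indicator A) + t (indicator B)"
      using AB by (simp add: t_add integrable_indicator)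
  next
    fix A assume A: "A \<in> sets M"
    have "(\<integral>\<omega>. norm (indicator A \<omega> :: 'k) \<partial>M) = (\<integral>\<omega>. indicator A \<omega> \<partial>M)"
      by (intro Bochner_Integration.integral_cong) (auto simp: indicator_def)
    then show "norm (t (indicator A)) \<le> C * measure M A"
      using C(2)[OF integrable_indicator[OF A]] A by simp
  qed (rule C(1))
  then show ?thesis by blast
qed

lemma norm_integral_split:
  fixes f :: "'a \<Rightarrow> 'k"
  assumes A: "A \<in> sets M" and f: "integrable M f"
  shows "(\<integral>\<omega>. norm (indicator (space M - A) \<omega> * f \<omega>) \<partial>M) + norm (\<integral>\<omega>. indicator A \<omega> * f \<omega> \<partial>M)
    \<le> (\<integral>\<omega>. norm (f \<omega>) \<partial>M)"
proof -
  have A': "space M - A \<in> sets M" using A by auto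
  have "norm (\<integral>\<omega>. indicator A \<omega> * f \<omega> \<partial>M) \<le> (\<integral>\<omega>. norm (indicator A \<omega> * f \<omega>) \<partial>M)"
    by (rule integral_norm_bound)
  moreover have "(\<integral>\<omega>. norm (indicator (space M - A) \<omega> * f \<omega>) \<partial>M) + (\<integral>\<omega>. norm (indicator A \<omega> * f \<omega>) \<partial>M)
      = (\<integral>\<omega>. norm (indicator (space M - A) \<omega> * f \<omega>) + norm (indicator A \<omega> * f \<omega>) \<partial>M)"
    using integrable_indicator_mult[OF A f] integrable_indicator_mult[OF A' f]
    by (intro Bochner_Integration.integral_add[symmetric] integrable_norm)
  moreover have "\<dots> = (\<integral>\<omega>. norm (f \<omega>) \<partial>M)"
    by (intro Bochner_Integration.integral_cong) (auto simp: indicator_def)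
  ultimately show ?thesis by linarith
qed

text \<open>
  Only the action on functions supported in \<open>A\<close> changes, and it becomes one of rank one: weak
  compactness survives, and what happens on \<open>A\<close> is governed by a single scalar.
\<close>

definition replace_on :: "'a set \<Rightarrow> 'y \<Rightarrow> ('a \<Rightarrow> 'k) \<Rightarrow> 'y" where
  "replace_on A z f = t (\<lambda>\<omega>. indicator (space M - A) \<omega> * f \<omega>) + smul (\<integral>\<omega>. indicator A \<omega> * f \<omega> \<partial>M) z"

lemma norm_replace_on_le:
  assumes A: "A \<in> sets M" and f: "integrable M f"
    and \<tau>: "\<And>f. integrable M f \<Longrightarrow> norm (t f) \<le> \<tau> * (\<integral>\<omega>. norm (f \<omega>) \<partial>M)"
  shows "norm (replace_on A z f) \<le> \<tau> * (\<integral>\<omega>. norm (indicator (space M - A) \<omega> * f \<omega>) \<partial>M)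
    + norm z * norm (\<integral>\<omega>. indicator A \<omega> * f \<omega> \<partial>M)"
  unfolding replace_on_def
proof (rule norm_triangle_le[OF add_mono])
  show "norm (t (\<lambda>\<omega>. indicator (space M - A) \<omega> * f \<omega>))
      \<le> \<tau> * (\<integral>\<omega>. norm (indicator (space M - A) \<omega> * f \<omega>) \<partial>M)"
    using A f by (intro \<tau> integrable_indicator_mult) auto
qed (simp add: norm_smul mult.commute)

lemma L1_operator_replace_on:
  assumes A: "A \<in> sets M"
  shows "L1_operator M smul (replace_on A z)"
proof (intro L1_operator.intro L1_operator_axioms.intro)
  show "finite_measure M" "banach_space_over smul" by unfold_locales
  have A': "space M - A \<in> sets M" using A by auto
  note int = integrable_indicator_mult[OF A] integrable_indicator_mult[OF A']
  show "replace_on A z (\<lambda>\<omega>. f \<omega> + g \<omega>) = replace_on A z f + replace_on A z g"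
    if f: "integrable M f" and g: "integrable M g" for f g
    using int[OF f] int[OF g]
    by (simp add: replace_on_def distrib_left t_add scale_left_distrib)
  show "replace_on A z (\<lambda>\<omega>. c * f \<omega>) = smul c (replace_on A z f)" if f: "integrable M f" for c f
  proof -
    have eq: "(\<lambda>\<omega>. indicator E \<omega> * (c * f \<omega>)) = (\<lambda>\<omega>. c * (indicator E \<omega> * f \<omega>))" for E
      by (simp add: mult.left_commute)
    show ?thesis
      using int[OF f] unfolding replace_on_def eq by (simp add: t_scale scale_right_distrib)
  qed
  obtain C where C: "0 \<le> C" "\<And>f. integrable M f \<Longrightarrow> norm (t f) \<le> C * (\<integral>\<omega>. norm (f \<omega>) \<partial>M)"
    using t_bound by blast
  have "norm (replace_on A z f) \<le> (C + norm z) * (\<integral>\<omega>. norm (f \<omega>) \<partial>M)" if f: "integrable M f" for f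
  proof -
    have split: "(\<integral>\<omega>. norm (indicator (space M - A) \<omega> * f \<omega>) \<partial>M) + norm (\<integral>\<omega>. indicator A \<omega> * f \<omega> \<partial>M)
        \<le> (\<integral>\<omega>. norm (f \<omega>) \<partial>M)" (is "?a + ?b \<le> ?n")
      by (rule norm_integral_split[OF A f])
    have "?a \<ge> 0" "?b \<ge> 0" by simp_all
    with split have "?a \<le> ?n" "?b \<le> ?n" by linarith+
    have "norm (replace_on A z f) \<le> C * ?a + norm z * ?b"
      by (rule norm_replace_on_le[OF A f C(2)])
    also have "\<dots> \<le> C * ?n + norm z * ?n"
      using C(1) \<open>?a \<le> ?n\<close> \<open>?b \<le> ?n\<close> by (intro add_mono mult_left_mono) auto
    finally show ?thesis by (simp add: distrib_right)
  qed
  then show "\<exists>C. \<forall>f. integrable M f \<longrightarrow> norm (replace_on A z f) \<le> C * (\<integral>\<omega>. norm (f \<omega>) \<partial>M)"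
    by blast
qed

text \<open>
  The exposing point is the normalised indicator of \<open>A\<close>, which is mapped to \<open>z\<close>.
\<close>

lemma RSE_replace_on:
  assumes A: "A \<in> sets M" "measure M A > 0"
    and \<tau>: "\<And>f. integrable M f \<Longrightarrow> norm (t f) \<le> \<tau> * (\<integral>\<omega>. norm (f \<omega>) \<partial>M)" "0 \<le> \<tau>" "\<tau> < norm z"
  shows "L1_operator.lift M (replace_on A z) \<in> RSE (L1 M) smul"
proof -
  interpret R: L1_operator M smul "replace_on A z" by (rule L1_operator_replace_on[OF A(1)])
  define a where "a f = (\<integral>\<omega>. norm (indicator (space M - A) \<omega> * f \<omega>) \<partial>M)" for f :: "'a \<Rightarrow> 'k"
  define b where "b f = (\<integral>\<omega>. indicator A \<omega> * f \<omega> \<partial>M)" for f :: "'a \<Rightarrow> 'k"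
  have a: "0 \<le> a f" for f by (simp add: a_def)
  have ab: "a f + norm (b f) \<le> (\<integral>\<omega>. norm (f \<omega>) \<partial>M)" if "integrable M f" for f
    unfolding a_def b_def by (rule norm_integral_split[OF A(1) that])
  have le: "norm (replace_on A z f) \<le> \<tau> * a f + norm z * norm (b f)" if "integrable M f" for f
    unfolding a_def b_def by (rule norm_replace_on_le[OF A(1) that \<tau>(1)])
  define x0 where "x0 \<omega> = of_real (1 / measure M A) * (indicator A \<omega> :: 'k)" for \<omega>
  have int_ind: "integrable M (indicator A :: 'a \<Rightarrow> 'k)" by (rule integrable_indicator[OF A(1)])
  have int_x0: "integrable M x0" unfolding x0_def using int_ind by simp
  have norm_x0: "(\<integral>\<omega>. norm (x0 \<omega>) \<partial>M) = 1"
  proof -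
    have "(\<integral>\<omega>. norm (x0 \<omega>) \<partial>M) = (\<integral>\<omega>. 1 / measure M A * indicator A \<omega> \<partial>M)"
      unfolding x0_def by (intro Bochner_Integration.integral_cong) (auto simp: indicator_def norm_mult norm_divide)
    then show ?thesis using A by simp
  qed
  have R_x0: "replace_on A z x0 = z"
  proof -
    have "t (\<lambda>\<omega>. indicator (space M - A) \<omega> * x0 \<omega>) = t (\<lambda>_. 0)"
      by (rule arg_cong[where f = t]) (auto simp: x0_def indicator_def)
    moreover have "(\<integral>\<omega>. indicator A \<omega> * x0 \<omega> \<partial>M) = (\<integral>\<omega>. (1 / measure M A * indicator A \<omega>) *\<^sub>R (1 :: 'k) \<partial>M)"
      by (intro Bochner_Integration.integral_cong) (auto simp: x0_def indicator_def scaleR_conv_of_real)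
    moreover have "\<dots> = 1"
      using A integrable_indicator[OF A(1), where 'b = real] by (subst integral_scaleR_left) auto
    ultimately show ?thesis by (simp add: replace_on_def t_zero)
  qed
  have ball: "norm (replace_on A z f) \<le> norm z" if f: "integrable M f" "(\<integral>\<omega>. norm (f \<omega>) \<partial>M) \<le> 1" for f
  proof -
    have "\<tau> * a f + norm z * norm (b f) \<le> norm z * a f + norm z * norm (b f)"
      using \<tau>(3) a by (intro add_mono mult_right_mono) auto
    also have "\<dots> = norm z * (a f + norm (b f))" by (simp add: distrib_left)
    also have "\<dots> \<le> norm z * 1" using ab[OF f(1)] f(2) by (intro mult_left_mono) auto
    finally show ?thesis using le[OF f(1)] by simp
  qed
  have op_norm: "op_norm (L1 M) R.lift = norm z"
  proof (rule antisym)
    show "op_norm (L1 M) R.lift \<le> norm z"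
      using ball by (intro op_norm_le) (auto simp: unit_ball_L1 R.lift_L1_class)
    obtain C where C: "\<And>f. integrable M f \<Longrightarrow> norm (replace_on A z f) \<le> C * (\<integral>\<omega>. norm (f \<omega>) \<partial>M)"
      using R.t_bound by blast
    have "norm (R.lift (L1_class M x0)) \<le> op_norm (L1 M) R.lift"
    proof (rule op_norm_upper)
      show "norm (R.lift x) \<le> C * vnorm (L1 M) x" if "x \<in> points (L1 M)" for x
        using that C by (auto simp: points_L1 R.lift_L1_class vnorm_L1)
      show "L1_class M x0 \<in> unit_ball (L1 M)"
        unfolding unit_ball_L1 using int_x0 norm_x0 by auto
    qed
    then show "norm z \<le> op_norm (L1 M) R.lift" by (simp add: R.lift_L1_class int_x0 R_x0)
  qed
  have "\<exists>\<sigma> \<theta>. strict_mono \<sigma> \<and> norm \<theta> = 1 \<and>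
      (\<lambda>n. R.lift (x (\<sigma> n))) \<longlonglongrightarrow> smul \<theta> (R.lift (L1_class M x0))"
    if x: "\<And>n. x n \<in> unit_ball (L1 M)" and lim: "(\<lambda>n. norm (R.lift (x n))) \<longlonglongrightarrow> op_norm (L1 M) R.lift"
    for x :: "nat \<Rightarrow> ('a \<Rightarrow> 'k) set"
  proof -
    have "\<forall>n. \<exists>f. x n = L1_class M f \<and> integrable M f \<and> (\<integral>\<omega>. norm (f \<omega>) \<partial>M) \<le> 1"
      using x unfolding unit_ball_L1 by blast
    then obtain f where f: "\<And>n. x n = L1_class M (f n)" "\<And>n. integrable M (f n)"
        "\<And>n. (\<integral>\<omega>. norm (f n \<omega>) \<partial>M) \<le> 1"
      by metis
    have lift: "R.lift (x n) = replace_on A z (f n)" for n by (simp add: f R.lift_L1_class)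
    have ab1: "a (f n) + norm (b (f n)) \<le> 1" for n using ab[OF f(2)] f(3) by (rule order_trans)
    have "(\<lambda>n. norm (replace_on A z (f n))) \<longlonglongrightarrow> norm z" using lim by (simp add: lift op_norm)
    from mass_concentrates[OF a ab1 le[OF f(2)] this \<tau>(2,3)]
    have a0: "(\<lambda>n. a (f n)) \<longlonglongrightarrow> 0" and b1: "(\<lambda>n. norm (b (f n))) \<longlonglongrightarrow> 1" .
    have "norm (b (f n)) \<le> 1" for n using ab1[of n] a[of "f n"] by linarith
    then have in_ball: "\<forall>n. b (f n) \<in> cball 0 1" by simp
    obtain \<theta> \<sigma> where \<sigma>: "strict_mono \<sigma>" "((\<lambda>n. b (f n)) \<circ> \<sigma>) \<longlonglongrightarrow> \<theta>"
      using seq_compactE[OF compact_imp_seq_compact[OF compact_cball[of "0 :: 'k" 1]] in_ball] by blast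
    then have \<sigma>: "strict_mono \<sigma>" "(\<lambda>n. b (f (\<sigma> n))) \<longlonglongrightarrow> \<theta>"
      by (simp_all add: o_def)
    have "(\<lambda>n. norm (b (f (\<sigma> n)))) \<longlonglongrightarrow> 1"
      using LIMSEQ_subseq_LIMSEQ[OF b1 \<sigma>(1)] by (simp add: o_def)
    then have "norm \<theta> = 1" using LIMSEQ_unique[OF tendsto_norm[OF \<sigma>(2)]] by simp
    have "(\<lambda>n. t (\<lambda>\<omega>. indicator (space M - A) \<omega> * f n \<omega>)) \<longlonglongrightarrow> 0"
    proof (rule Lim_null_comparison)
      show "\<forall>\<^sub>F n in sequentially. norm (t (\<lambda>\<omega>. indicator (space M - A) \<omega> * f n \<omega>)) \<le> \<tau> * a (f n)"
        unfolding a_def using A(1) f(2) by (intro always_eventually allI \<tau>(1) integrable_indicator_mult) auto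
      show "(\<lambda>n. \<tau> * a (f n)) \<longlonglongrightarrow> 0" using tendsto_mult_left[OF a0, of \<tau>] by simp
    qed
    from LIMSEQ_subseq_LIMSEQ[OF this \<sigma>(1)]
    have "(\<lambda>n. t (\<lambda>\<omega>. indicator (space M - A) \<omega> * f (\<sigma> n) \<omega>)) \<longlonglongrightarrow> 0" by (simp add: o_def)
    from tendsto_add[OF this bounded_linear.tendsto[OF bounded_linear_smul_left \<sigma>(2)], of z]
    have "(\<lambda>n. R.lift (x (\<sigma> n))) \<longlonglongrightarrow> smul \<theta> z"
      by (simp add: lift replace_on_def b_def)
    then show ?thesis using \<sigma>(1) \<open>norm \<theta> = 1\<close> by (auto simp: R.lift_L1_class int_x0 R_x0)
  qed
  moreover have "L1_class M x0 \<in> unit_sphere (L1 M)"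
    using int_x0 norm_x0 by (auto simp: unit_sphere_def points_L1 vnorm_L1)
  ultimately show ?thesis
    unfolding RSE_def using R.lift_bounded_operator by blast
qed

lemma weakly_compact_replace_on:
  assumes A: "A \<in> sets M" and weak: "weak_topology smul = weak" and K: "compactin weak K"
    and ball: "\<And>f. integrable M f \<Longrightarrow> (\<integral>\<omega>. norm (f \<omega>) \<partial>M) \<le> 1 \<Longrightarrow> t f \<in> K"
  shows "L1_operator.lift M (replace_on A z) \<in> weakly_compact_operators (L1 M) smul"
proof -
  interpret R: L1_operator M smul "replace_on A z" by (rule L1_operator_replace_on[OF A])
  define L where "L = (\<lambda>c. smul c z) ` cball 0 1"
  have "compact L"
    unfolding L_def
    by (intro compact_continuous_image linear_continuous_on bounded_linear_smul_left compact_cball)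
  then have "compactin weak {k + l |k l. k \<in> K \<and> l \<in> L}"
    by (intro compactin_weak_sums[OF K] compact_imp_compactin_weak)
  moreover have "R.lift ` unit_ball (L1 M) \<subseteq> {k + l |k l. k \<in> K \<and> l \<in> L}"
  proof
    fix y assume "y \<in> R.lift ` unit_ball (L1 M)"
    then obtain f where f: "integrable M f" "(\<integral>\<omega>. norm (f \<omega>) \<partial>M) \<le> 1" "y = replace_on A z f"
      by (auto simp: unit_ball_L1 R.lift_L1_class)
    have split: "(\<integral>\<omega>. norm (indicator (space M - A) \<omega> * f \<omega>) \<partial>M) + norm (\<integral>\<omega>. indicator A \<omega> * f \<omega> \<partial>M) \<le> 1"
      (is "?a + norm ?b \<le> 1")
      using norm_integral_split[OF A f(1)] f(2) by (rule order_trans)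
    have "?a \<ge> 0" "norm ?b \<ge> 0" by simp_all
    then have "?a \<le> 1" "norm ?b \<le> 1" using split by linarith+
    have "t (\<lambda>\<omega>. indicator (space M - A) \<omega> * f \<omega>) \<in> K"
      using A f(1) \<open>?a \<le> 1\<close> by (intro ball integrable_indicator_mult) auto
    moreover have "smul ?b z \<in> L" unfolding L_def using \<open>norm ?b \<le> 1\<close> by (intro imageI) simp
    ultimately show "y \<in> {k + l |k l. k \<in> K \<and> l \<in> L}" unfolding f(3) replace_on_def by blast
  qed
  ultimately have "compactin weak (weak closure_of (R.lift ` unit_ball (L1 M)))"
    by (rule compactin_closure_of_subset(1)[OF Hausdorff_weak])
  then show ?thesis
    unfolding weakly_compact_operators_def weak using R.lift_bounded_operator by blast
qed

lemma replace_on_approximates: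
  assumes A: "A \<in> sets M"
    and near: "\<And>E. E \<in> sets M \<Longrightarrow> norm (t (indicator (E \<inter> A)) - measure M (E \<inter> A) *\<^sub>R z) \<le> c * measure M (E \<inter> A)"
    and c: "0 \<le> c" and f: "integrable M f"
  shows "norm (t f - replace_on A z f) \<le> c * (\<integral>\<omega>. norm (f \<omega>) \<partial>M)"
proof -
  interpret R: L1_operator M smul "replace_on A z" by (rule L1_operator_replace_on[OF A])
  interpret D: L1_operator M smul "\<lambda>f. t f - replace_on A z f"
  proof (intro L1_operator.intro L1_operator_axioms.intro)
    show "finite_measure M" "banach_space_over smul" by unfold_locales
    show "t (\<lambda>\<omega>. f \<omega> + g \<omega>) - replace_on A z (\<lambda>\<omega>. f \<omega> + g \<omega>)
        = t f - replace_on A z f + (t g - replace_on A z g)"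
      if "integrable M f" "integrable M g" for f g
      using that by (simp add: t_add R.t_add)
    show "t (\<lambda>\<omega>. c * f \<omega>) - replace_on A z (\<lambda>\<omega>. c * f \<omega>) = smul c (t f - replace_on A z f)"
      if "integrable M f" for c f
      using that by (simp add: t_scale R.t_scale scale_right_diff_distrib)
    obtain C where C: "\<And>f. integrable M f \<Longrightarrow> norm (t f) \<le> C * (\<integral>\<omega>. norm (f \<omega>) \<partial>M)"
      using t_bound by blast
    obtain C' where C': "\<And>f. integrable M f \<Longrightarrow> norm (replace_on A z f) \<le> C' * (\<integral>\<omega>. norm (f \<omega>) \<partial>M)"
      using R.t_bound by blast
    have "norm (t f - replace_on A z f) \<le> (C + C') * (\<integral>\<omega>. norm (f \<omega>) \<partial>M)" if "integrable M f" for f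
      using norm_triangle_ineq4[of "t f" "replace_on A z f"] C[OF that] C'[OF that]
      by (simp add: distrib_right)
    then show "\<exists>C. \<forall>f. integrable M f \<longrightarrow> norm (t f - replace_on A z f) \<le> C * (\<integral>\<omega>. norm (f \<omega>) \<partial>M)"
      by blast
  qed
  show ?thesis
  proof (rule D.norm_le_if_indicator_le[OF _ f])
    fix E assume E: "E \<in> sets M"
    have "indicator E = (\<lambda>\<omega>. indicator (E \<inter> A) \<omega> + indicator (E - A) \<omega> :: 'k)"
      by (auto simp: fun_eq_iff indicator_def)
    then have "t (indicator E) = t (indicator (E \<inter> A)) + t (indicator (E - A))"
      using A E by (simp add: t_add integrable_indicator)
    moreover have "(\<lambda>\<omega>. indicator (space M - A) \<omega> * indicator E \<omega> :: 'k) = indicator (E - A)"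
      using sets.sets_into_space[OF E] by (auto simp: fun_eq_iff indicator_def)
    moreover have "(\<integral>\<omega>. indicator A \<omega> * indicator E \<omega> \<partial>M) = (of_real (measure M (E \<inter> A)) :: 'k)"
    proof -
      have "(\<integral>\<omega>. indicator A \<omega> * indicator E \<omega> \<partial>M) = (\<integral>\<omega>. indicator (E \<inter> A) \<omega> *\<^sub>R (1 :: 'k) \<partial>M)"
        by (intro Bochner_Integration.integral_cong) (auto simp: indicator_def)
      also have "\<dots> = measure M (E \<inter> A) *\<^sub>R 1"
        using A E integrable_indicator[of "E \<inter> A", where 'b = real] by (subst integral_scaleR_left) auto
      finally show ?thesis by (simp add: scaleR_conv_of_real)
    qed
    ultimately have "t (indicator E) - replace_on A z (indicator E)
        = t (indicator (E \<inter> A)) - measure M (E \<inter> A) *\<^sub>R z"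
      by (simp add: replace_on_def smul_of_real)
    also have "norm \<dots> \<le> c * measure M (E \<inter> A)" by (rule near[OF E])
    also have "\<dots> \<le> c * measure M E"
      using c E by (intro mult_left_mono finite_measure_mono) auto
    finally show "norm (t (indicator E) - replace_on A z (indicator E)) \<le> c * measure M E" .
  qed
qed

end


theorem weakly_compact_operators_closed:
  fixes smul :: "'k::{real_normed_field, euclidean_space} \<Rightarrow> 'y::banach \<Rightarrow> 'y"
  assumes weak: "weak_topology smul = weak"
    and T: "T \<in> op_closure (L1 M) smul (weakly_compact_operators (L1 M) smul \<inter> R)"
  shows "T \<in> weakly_compact_operators (L1 M) smul"
proof -
  have T: "T \<in> bounded_operators (L1 M) smul"
    "\<And>e. e > 0 \<Longrightarrow> \<exists>S\<in>weakly_compact_operators (L1 M) smul. op_norm (L1 M) (\<lambda>x. T x - S x) < e"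
    using T by (auto simp: op_closure_def)
  obtain C where C: "\<forall>x\<in>points (L1 M). norm (T x) \<le> C * vnorm (L1 M) x"
    using T(1) unfolding bounded_operators_def by blast
  have "compactin weak (weak closure_of (T ` unit_ball (L1 M)))"
  proof (rule weakly_compact_if_approximable)
    fix e :: real assume "e > 0"
    then obtain S where S: "S \<in> weakly_compact_operators (L1 M) smul"
        "op_norm (L1 M) (\<lambda>x. T x - S x) < e"
      using T(2) by blast
    define K where "K = weak closure_of (S ` unit_ball (L1 M))"
    have K: "compactin weak K"
      using S(1) by (simp add: weakly_compact_operators_def weak K_def)
    have SK: "S x \<in> K" if "x \<in> unit_ball (L1 M)" for x
      using closure_of_subset[of "S ` unit_ball (L1 M)" weak] that by (auto simp: K_def)
    obtain C' where C': "\<forall>x\<in>points (L1 M). norm (S x) \<le> C' * vnorm (L1 M) x"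
      using S(1) unfolding weakly_compact_operators_def bounded_operators_def by blast
    have "norm (T x - S x) \<le> (C + C') * vnorm (L1 M) x" if "x \<in> points (L1 M)" for x
      using norm_triangle_ineq4[of "T x" "S x"] bspec[OF C that] bspec[OF C' that]
      by (simp add: distrib_right)
    then have "norm (T x - S x) \<le> op_norm (L1 M) (\<lambda>x. T x - S x)" if "x \<in> unit_ball (L1 M)" for x
      using that by (rule op_norm_upper)
    then have "norm (T x - S x) \<le> e" if "x \<in> unit_ball (L1 M)" for x
      using S(2) that by (meson less_imp_le order_trans)
    then show "\<exists>K. compactin weak K \<and> (\<forall>s\<in>T ` unit_ball (L1 M). \<exists>k\<in>K. norm (s - k) \<le> e)"
      using K SK by blast
  qed
  then show ?thesis using T(1) by (simp add: weakly_compact_operators_def weak)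
qed

text \<open>
  With \<open>y\<close> and \<open>A\<close> as in \<open>nearly_constant_norming_piece\<close>, the vector \<open>z\<close> has norm \<open>\<parallel>y\<parallel> + 2\<epsilon>\<close>, which
  exceeds the bound \<open>\<parallel>y\<parallel> + \<epsilon>\<close> for \<open>\<parallel>T\<parallel>\<close>.
\<close>

theorem weakly_compact_operator_approximable_by_RSE:
  fixes smul :: "'k::{real_normed_field, euclidean_space} \<Rightarrow> 'y::banach \<Rightarrow> 'y"
  assumes M: "finite_measure M" "measure M (space M) > 0" and Y: "\<exists>y :: 'y. y \<noteq> 0"
    and smul: "banach_space_over smul" and weak: "weak_topology smul = weak"
    and T: "T \<in> weakly_compact_operators (L1 M) smul" and e: "e > 0"
  shows "\<exists>S\<in>weakly_compact_operators (L1 M) smul \<inter> RSE (L1 M) smul.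
    op_norm (L1 M) (\<lambda>x. T x - S x) < e"
proof -
  define t where "t f = T (L1_class M f)" for f
  have TB: "T \<in> bounded_operators (L1 M) smul"
    using T by (simp add: weakly_compact_operators_def)
  interpret L1_operator M smul t
    unfolding t_def by (rule L1_operator_if_bounded_operator[OF M(1) smul TB])
  define K where "K = weak closure_of (T ` unit_ball (L1 M))"
  have K: "compactin weak K"
    using T by (simp add: weakly_compact_operators_def weak K_def)
  have TK: "t f \<in> K" if "integrable M f" "(\<integral>\<omega>. norm (f \<omega>) \<partial>M) \<le> 1" for f
    using closure_of_subset[of "T ` unit_ball (L1 M)" weak] that
    by (auto simp: K_def t_def unit_ball_L1)
  define m where "m E = t (indicator E)" for E
  obtain C where "dominated_vector_measure M m C"
    using dominated_vector_measure_indicator unfolding m_def by blast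
  then interpret m: dominated_vector_measure M m C .
  have averages: "m.averages \<subseteq> K"
  proof
    fix y assume "y \<in> m.averages"
    then obtain E where E: "E \<in> sets M" "measure M E > 0" "y = m E /\<^sub>R measure M E"
      by (auto simp: m.averages_def)
    define f where "f \<omega> = of_real (inverse (measure M E)) * (indicator E \<omega> :: 'k)" for \<omega>
    have f: "integrable M f" unfolding f_def by (intro integrable_mult_right integrable_indicator E(1))
    have "(\<integral>\<omega>. norm (f \<omega>) \<partial>M) = (\<integral>\<omega>. inverse (measure M E) * indicator E \<omega> \<partial>M)"
      unfolding f_def
      by (intro Bochner_Integration.integral_cong) (auto simp: indicator_def norm_mult norm_inverse)
    then have "t f \<in> K" using E by (intro TK f) simp
    moreover have "t f = y"
      unfolding f_def using integrable_indicator[OF E(1)]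
      by (subst t_scale) (simp_all add: smul_of_real E(3) m_def del: of_real_inverse)
    ultimately show "y \<in> K" by simp
  qed
  \<comment> \<open>\<open>z\<close> is at distance \<open>2\<epsilon>\<close> from \<open>y\<close>, so the total error is \<open>3\<epsilon> < e\<close>.\<close>
  define \<epsilon> where "\<epsilon> = e / 6"
  have \<epsilon>: "\<epsilon> > 0" using e by (simp add: \<epsilon>_def)
  obtain A y where A: "A \<in> sets M" "measure M A > 0"
    and near: "\<And>E. E \<in> sets M \<Longrightarrow> norm (m (E \<inter> A) - measure M (E \<inter> A) *\<^sub>R y) \<le> \<epsilon> * measure M (E \<inter> A)"
    and norming: "\<And>E. E \<in> sets M \<Longrightarrow> norm (m E) \<le> (norm y + \<epsilon>) * measure M E"
    using m.nearly_constant_norming_piece[OF K averages \<epsilon> M(2)] by blast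
  \<comment> \<open>If \<open>y = 0\<close>, any direction will do; this is where \<open>Y \<noteq> {0}\<close> enters.\<close>
  have "\<exists>u. norm u = 1 \<and> y = norm y *\<^sub>R u"
  proof (cases "y = 0")
    case True
    obtain v :: 'y where "v \<noteq> 0" using Y by blast
    then show ?thesis using True by (intro exI[of _ "v /\<^sub>R norm v"]) simp
  next
    case False
    then show ?thesis by (intro exI[of _ "y /\<^sub>R norm y"]) simp
  qed
  then obtain u where u: "norm u = 1" "y = norm y *\<^sub>R u" by blast
  define z where "z = y + (2 * \<epsilon>) *\<^sub>R u"
  have "z = (norm y + 2 * \<epsilon>) *\<^sub>R u" using u(2) by (simp add: z_def scaleR_left_distrib)
  then have norm_z: "norm z = norm y + 2 * \<epsilon>" using u(1) \<epsilon> by simp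
  define S where "S = L1_operator.lift M (replace_on A z)"
  interpret R: L1_operator M smul "replace_on A z" by (rule L1_operator_replace_on[OF A(1)])
  have "norm (t f) \<le> (norm y + \<epsilon>) * (\<integral>\<omega>. norm (f \<omega>) \<partial>M)" if "integrable M f" for f
    using norming that unfolding m_def by (rule norm_le_if_indicator_le)
  then have "S \<in> RSE (L1 M) smul"
    unfolding S_def using \<epsilon> by (intro RSE_replace_on[OF A]) (auto simp: norm_z)
  moreover have "S \<in> weakly_compact_operators (L1 M) smul"
    unfolding S_def by (rule weakly_compact_replace_on[OF A(1) weak K TK])
  moreover have "op_norm (L1 M) (\<lambda>x. T x - S x) \<le> 3 * \<epsilon>"
  proof (rule op_norm_le)
    fix x :: "('a \<Rightarrow> 'k) set" assume "x \<in> unit_ball (L1 M)"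
    then obtain f where f: "x = L1_class M f" "integrable M f" "(\<integral>\<omega>. norm (f \<omega>) \<partial>M) \<le> 1"
      by (auto simp: unit_ball_L1)
    have "norm (t f - replace_on A z f) \<le> 3 * \<epsilon> * (\<integral>\<omega>. norm (f \<omega>) \<partial>M)"
    proof (rule replace_on_approximates[OF A(1) _ _ f(2)])
      fix E assume E: "E \<in> sets M"
      have "t (indicator (E \<inter> A)) - measure M (E \<inter> A) *\<^sub>R z
          = (m (E \<inter> A) - measure M (E \<inter> A) *\<^sub>R y) - measure M (E \<inter> A) *\<^sub>R ((2 * \<epsilon>) *\<^sub>R u)"
        by (simp add: m_def z_def scaleR_right_distrib)
      also have "norm \<dots> \<le> \<epsilon> * measure M (E \<inter> A) + 2 * \<epsilon> * measure M (E \<inter> A)"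
        using u(1) \<epsilon> by (intro order_trans[OF norm_triangle_ineq4 add_mono[OF near[OF E]]]) (simp add: mult_ac)
      finally show "norm (t (indicator (E \<inter> A)) - measure M (E \<inter> A) *\<^sub>R z) \<le> 3 * \<epsilon> * measure M (E \<inter> A)"
        by simp
    qed (use \<epsilon> in simp)
    also have "\<dots> \<le> 3 * \<epsilon> * 1" using f(3) \<epsilon> by (intro mult_left_mono) auto
    finally show "norm (T x - S x) \<le> 3 * \<epsilon>"
      using f by (simp add: S_def R.lift_L1_class t_def)
  qed
  moreover have "3 * \<epsilon> < e" using e by (simp add: \<epsilon>_def)
  ultimately show ?thesis by (meson IntI order_le_less_trans)
qed

lemma measure_space_pos_if_L1_nonzero:
  assumes "finite_measure M"
    and "points (L1 M :: ('k::{real_normed_field, banach, second_countable_topology}, ('a \<Rightarrow> 'k) set) normed_space) \<noteq> {vzero (L1 M)}"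
  shows "measure M (space M) > 0"
proof (rule ccontr)
  interpret finite_measure M by fact
  assume "\<not> measure M (space M) > 0"
  then have "emeasure M (space M) = 0"
    by (simp add: emeasure_eq_measure zero_less_measure_iff)
  then have AE: "AE \<omega> in M. P \<omega>" for P
    by (intro AE_I[of _ _ "space M"]) auto
  have zero: "vzero (L1 M :: ('k, ('a \<Rightarrow> 'k) set) normed_space) = L1_class M (\<lambda>_. 0)"
    by (simp add: L1_def)
  have eq: "L1_class M f = L1_class M (\<lambda>_. 0)" if "integrable M f" for f :: "'a \<Rightarrow> 'k"
    using that AE by (intro L1_class_eq) auto
  have "points (L1 M :: ('k, ('a \<Rightarrow> 'k) set) normed_space) = {vzero (L1 M)}"
    unfolding zero
  proof (intro equalityI subsetI)
    fix x :: "('a \<Rightarrow> 'k) set" assume "x \<in> points (L1 M)"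
    then obtain f where "x = L1_class M f" "integrable M f" unfolding points_L1 by blast
    then show "x \<in> {L1_class M (\<lambda>_. 0)}" using eq by blast
  next
    fix x :: "('a \<Rightarrow> 'k) set" assume "x \<in> {L1_class M (\<lambda>_. 0)}"
    then show "x \<in> points (L1 M)" using L1_class_in_points[of M "\<lambda>_. 0"] by simp
  qed
  then show False using assms(2) by simp
qed

theorem weakly_compact_operators_eq_closure:
  fixes M :: "'a measure" and smul :: "'k::{real_normed_field, euclidean_space} \<Rightarrow> 'y::banach \<Rightarrow> 'y"
  assumes M: "finite_measure M" and Y: "\<exists>y :: 'y. y \<noteq> 0"
    and nonzero: "points (L1 M :: ('k, ('a \<Rightarrow> 'k) set) normed_space) \<noteq> {vzero (L1 M)}"
    and smul: "banach_space_over smul" and weak: "weak_topology smul = weak"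
  shows "weakly_compact_operators (L1 M) smul =
    op_closure (L1 M) smul (weakly_compact_operators (L1 M) smul \<inter> RSE (L1 M) smul)"
proof (intro equalityI subsetI)
  fix T assume T: "T \<in> weakly_compact_operators (L1 M) smul"
  show "T \<in> op_closure (L1 M) smul (weakly_compact_operators (L1 M) smul \<inter> RSE (L1 M) smul)"
    unfolding op_closure_def
  proof (intro CollectI conjI allI impI)
    show "T \<in> bounded_operators (L1 M) smul"
      using T by (simp add: weakly_compact_operators_def)
  qed (rule weakly_compact_operator_approximable_by_RSE[OF M measure_space_pos_if_L1_nonzero[OF M nonzero] Y smul weak T])
next
  fix T assume "T \<in> op_closure (L1 M) smul (weakly_compact_operators (L1 M) smul \<inter> RSE (L1 M) smul)"
  then show "T \<in> weakly_compact_operators (L1 M) smul"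
    by (rule weakly_compact_operators_closed[OF weak])
qed

theorem corollary3p9:
  fixes M :: "'a measure"
  assumes "finite_measure M"
    and "\<exists>y :: 'y::banach. y \<noteq> 0"
  shows
    "(points (L1 M :: (real, ('a \<Rightarrow> real) set) normed_space) \<noteq> {vzero (L1 M)} \<longrightarrow>
      (\<forall>smul :: real \<Rightarrow> 'y \<Rightarrow> 'y. banach_space_over smul \<longrightarrow>
        weakly_compact_operators (L1 M) smul =
        op_closure (L1 M) smul (weakly_compact_operators (L1 M) smul \<inter> RSE (L1 M) smul))) \<and>
     (points (L1 M :: (complex, ('a \<Rightarrow> complex) set) normed_space) \<noteq> {vzero (L1 M)} \<longrightarrow>
      (\<forall>smul :: complex \<Rightarrow> 'y \<Rightarrow> 'y. banach_space_over smul \<longrightarrow>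
        weakly_compact_operators (L1 M) smul =
        op_closure (L1 M) smul (weakly_compact_operators (L1 M) smul \<inter> RSE (L1 M) smul)))"
proof (intro conjI impI allI)
  fix smul :: "real \<Rightarrow> 'y \<Rightarrow> 'y"
  assume "points (L1 M :: (real, ('a \<Rightarrow> real) set) normed_space) \<noteq> {vzero (L1 M)}" "banach_space_over smul"
  then show "weakly_compact_operators (L1 M) smul =
      op_closure (L1 M) smul (weakly_compact_operators (L1 M) smul \<inter> RSE (L1 M) smul)"
    by (intro weakly_compact_operators_eq_closure assms weak_topology_real)
next
  fix smul :: "complex \<Rightarrow> 'y \<Rightarrow> 'y"
  assume "points (L1 M :: (complex, ('a \<Rightarrow> complex) set) normed_space) \<noteq> {vzero (L1 M)}" "banach_space_over smul"
  then show "weakly_compact_operators (L1 M) smul =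
      op_closure (L1 M) smul (weakly_compact_operators (L1 M) smul \<inter> RSE (L1 M) smul)"
    by (intro weakly_compact_operators_eq_closure assms weak_topology_complex)
qed

end
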